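(* For every dimension $n\ge 1$ there is a constant $K_n>0$, determined only by $n$ (in particular independent of $s$ and $\lambda$), such that the following holds. Let $s\in(0,1)$, let $\Omega\subset\mathbb{R}^n$ be a bounded open domain, let $I:=\min\{R:\ \Omega\subset B_R(\mathbf{x})\ \ \forall\,\mathbf{x}\in\Omega\}$, let $\lambda>I$, and let $\Omega_{\mathcal I}$ be the interaction domain of $\Omega$ with interaction radius $\lambda$, where $\Omega$, $\Omega_{\mathcal I}$ and $\Omega\cup\Omega_{\mathcal I}$ satisfy the standing assumptions given in the context. Let $f\in L^2(\Omega)$. Let $u\in H^s_\Omega(\mathbb{R}^n)$ be the solution of $$\frac{c_{n,s}}{2}\int_{\mathbb{R}^n}\int_{\mathbb{R}^n}\frac{u(\mathbf{y})-u(\mathbf{x})}{|\mathbf{x}-\mathbf{y}|^{n+2s}}\big(v(\mathbf{y})-v(\mathbf{x})\big)\,d\mathbf{y}\,d\mathbf{x}=\int_\Omega f v\,d\mathbf{x}\qquad\forall\,v\in H^s_\Omega(\mathbb{R}^n),$$ and let $\widetilde u\in V_c(\Omega\cup\Omega_{\mathcal I})$ be the solution of $$\frac{c_{n,s}}{2}\int_{\Omega\cup\Omega_{\mathcal I}}\int_{(\Omega\cup\Omega_{\mathcal I})\cap B_\lambda(\mathbf{x})}\frac{\widetilde u(\mathbf{y})-\widetilde u(\mathbf{x})}{|\mathbf{x}-\mathbf{y}|^{n+2s}}\big(v(\mathbf{y})-v(\mathbf{x})\big)\,d\mathbf{y}\,d\mathbf{x}=\int_\Omega f v\,d\mathbf{x}\qquad\forall\,v\in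 V_c(\Omega\cup\Omega_{\mathcal I}).$$ Let $C_1>0$ be a constant such that $C_1\|v\|_{H^s(\Omega\cup\Omega_{\mathcal I})}\le |||v|||$ for all $v\in V_c(\Omega\cup\Omega_{\mathcal I})$. Then $$\|u-\widetilde u\|_{H^s(\Omega\cup\Omega_{\mathcal I})}\le\frac{K_n}{C_1^2\,s\,(\lambda-I)^{2s}}\,\|u\|_{L^2(\Omega)}$$ and $$\|u-\widetilde u\|_{L^2(\Omega)}\le\frac{K_n}{C_1^2\,s\,(\lambda-I)^{2s}}\,\|u\|_{L^2(\Omega)}.$$
   Context: $B_R(\mathbf{x})=\{\mathbf{y}\in\mathbb{R}^n: |\mathbf{y}-\mathbf{x}|\le R\}$ is the closed ball. The interaction domain is $\Omega_{\mathcal I}=\{\mathbf{y}\in\mathbb{R}^n\setminus\Omega:\ |\mathbf{x}-\mathbf{y}|\le\lambda\ \text{for some }\mathbf{x}\in\Omega\}$. Standing assumptions: $\Omega$, $\Omega_{\mathcal I}$ and $\Omega\cup\Omega_{\mathcal I}$ are bounded with piecewise smooth boundary and satisfy the interior cone condition. The constant $c_{n,s}=s\,2^{2s}\,\dfrac{\Gamma\left(\frac{n+2s}{2}\right)}{\pi^{n/2}\,\Gamma(1-s)}$ is the normalizing constant of the fractional Laplacian $(-\Delta)^s u(\mathbf{x})=c_{n,s}\int_{\mathbb{R}^n}\frac{u(\mathbf{x})-u(\mathbf{y})}{|\mathbf{y}-\mathbf{x}|^{n+2s}}d\mathbf{y}$ (Fourier symbol $|\xi|^{2s}$). For a domain $D\subseteq\mathbb{R}^n$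 and $s\in(0,1)$, $|v|^2_{H^s(D)}:=\int_D\int_D\frac{(v(\mathbf{y})-v(\mathbf{x}))^2}{|\mathbf{y}-\mathbf{x}|^{n+2s}}\,d\mathbf{y}\,d\mathbf{x}$, $\|v\|_{H^s(D)}:=\|v\|_{L^2(D)}+|v|_{H^s(D)}$, and $H^s(D)$ is the space of $v\in L^2(D)$ with $\|v\|_{H^s(D)}<\infty$. $H^s_\Omega(\mathbb{R}^n):=\{w\in H^s(\mathbb{R}^n): w=0\text{ in }\mathbb{R}^n\setminus\Omega\}$. The truncated kernel is $\widetilde\gamma(\mathbf{x},\mathbf{y})=\frac{c_{n,s}}{2|\mathbf{x}-\mathbf{y}|^{n+2s}}$ if $\mathbf{y}\in B_\lambda(\mathbf{x})$ and $\widetilde\gamma(\mathbf{x},\mathbf{y})=0$ otherwise. The nonlocal energy semi-norm is $$|||v|||:=\Big(\tfrac12\int_{\Omega\cup\Omega_{\mathcal I}}\int_{\Omega\cup\Omega_{\mathcal I}}\big(v(\mathbf{y})-v(\mathbf{x})\big)^2\,\widetilde\gamma(\mathbf{x},\mathbf{y})\,d\mathbf{y}\,d\mathbf{x}\Big)^{1/2},$$ $V(\Omega\cup\Omega_{\mathcal I}):=\{v\in L^2(\Omega\cup\Omega_{\mathcal I}): |||v|||<\infty\}$, and $V_c(\Omega\cup\Omega_{\mathcal I}):=\{v\in V(\Omega\cup\Omega_{\mathcal I}): v=0\text{ on }\Omega_{\mathcal I}\}$. It is known that there are positive constants $C_1,C_2$ with $C_1\|v\|_{H^s(\Omega\cup\Omega_{\mathcal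 I})}\le|||v|||\le C_2\|v\|_{H^s(\Omega\cup\Omega_{\mathcal I})}$ for all $v\in V_c(\Omega\cup\Omega_{\mathcal I})$, and that both weak problems have unique solutions. In the difference $u-\widetilde u$, $u$ is restricted to $\Omega\cup\Omega_{\mathcal I}$. *)

theory Defs
  imports "HOL-Analysis.Analysis"
begin

section \<open>Geometry of the domain\<close>

text \<open>The interaction radius is written \<open>\<delta>\<close>, since lambda is reserved for abstraction.\<close>

definition interaction_domain :: "real \<Rightarrow> (real^'n) set \<Rightarrow> (real^'n) set" where
  "interaction_domain \<delta> \<Omega> = {y. y \<notin> \<Omega> \<and> (\<exists>x\<in>\<Omega>. norm (x - y) \<le> \<delta>)}"

text \<open>For a bounded nonempty set the minimum is attained.\<close>

definition covering_radius :: "(real^'n) set \<Rightarrow> real" where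
  "covering_radius \<Omega> = (LEAST R. \<forall>x\<in>\<Omega>. \<Omega> \<subseteq> cball x R)"

definition finite_cone :: "real^'n \<Rightarrow> real^'n \<Rightarrow> real \<Rightarrow> real \<Rightarrow> (real^'n) set" where
  "finite_cone x \<xi> \<theta> r = {x + t *\<^sub>R w | t w. 0 \<le> t \<and> t \<le> r \<and> norm w = 1 \<and> cos \<theta> \<le> w \<bullet> \<xi>}"

definition interior_cone_condition :: "(real^'n) set \<Rightarrow> bool" where
  "interior_cone_condition D \<longleftrightarrow>
     (\<exists>\<theta> r. 0 < \<theta> \<and> \<theta> < pi / 2 \<and> 0 < r \<and> (\<forall>x\<in>D. \<exists>\<xi>. norm \<xi> = 1 \<and> finite_cone x \<xi> \<theta> r \<subseteq> D))"

fun Ck_on :: "nat \<Rightarrow> (real^'n) set \<Rightarrow> (real^'n \<Rightarrow> real^'n) \<Rightarrow> bool" where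
  "Ck_on 0 U f \<longleftrightarrow> continuous_on U f"
| "Ck_on (Suc k) U f \<longleftrightarrow>
     f differentiable_on U \<and> (\<forall>b\<in>Basis. Ck_on k U (\<lambda>x. frechet_derivative f (at x) b))"

definition smooth_embedding_on :: "(real^'n) set \<Rightarrow> (real^'n \<Rightarrow> real^'n) \<Rightarrow> bool" where
  "smooth_embedding_on U \<phi> \<longleftrightarrow>
     open U \<and> inj_on \<phi> U \<and> (\<forall>k. Ck_on k U \<phi>) \<and> (\<forall>x\<in>U. inj (frechet_derivative \<phi> (at x)))"

text \<open>The \<open>(n - 1)\<close>-dimensional unit cube, realised as a face of the unit cube of \<open>\<real>\<^sup>n\<close>
  (for \<open>n = 1\<close> it is a single point).\<close>

definition unit_face :: "'n \<Rightarrow> (real^'n) set" where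
  "unit_face k = {x \<in> cbox 0 1. x $ k = 0}"

text \<open>The boundary is a finite union of smooth hypersurface patches that do not overlap except
  along the patch boundaries.  A patch is the image of the \<open>(n - 1)\<close>-cube under a smooth
  diffeomorphism of a neighbourhood of it in \<open>\<real>\<^sup>n\<close> onto an open subset of \<open>\<real>\<^sup>n\<close>.
  The choice of the face \<open>k\<close> is immaterial.\<close>

definition piecewise_smooth_boundary :: "(real^'n) set \<Rightarrow> bool" where
  "piecewise_smooth_boundary D \<longleftrightarrow>
     (\<exists>k. \<exists>\<Phi> :: (real^'n \<Rightarrow> real^'n) set. finite \<Phi> \<and>
        (\<forall>\<phi>\<in>\<Phi>. \<exists>U. unit_face k \<subseteq> U \<and> smooth_embedding_on U \<phi>) \<and>
        frontier D = (\<Union>\<phi>\<in>\<Phi>. \<phi> ` unit_face k) \<and>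
        pairwise (\<lambda>\<phi> \<psi>. disjnt (\<phi> ` rel_interior (unit_face k)) (\<psi> ` rel_interior (unit_face k))) \<Phi>)"

definition admissible_domain :: "(real^'n) set \<Rightarrow> bool" where
  "admissible_domain D \<longleftrightarrow>
     bounded D \<and> piecewise_smooth_boundary D \<and> interior_cone_condition D"

section \<open>Function spaces\<close>

text \<open>Elements of the spaces below are represented by Lebesgue measurable functions, which are
  only relevant up to null sets; vanishing on a set therefore means vanishing almost everywhere
  on it.  Norms take values in \<open>[0, \<infinity>]\<close>, so that no junk value arises when they are
  infinite.\<close>

definition esqrt :: "ennreal \<Rightarrow> ennreal" where
  "esqrt a = (if a = \<infinity> then \<infinity> else ennreal (sqrt (enn2real a)))"

definition L2_enorm :: "(real^'n) set \<Rightarrow> (real^'n \<Rightarrow> real) \<Rightarrow> ennreal" where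
  "L2_enorm D v = esqrt (\<integral>\<^sup>+x. ennreal ((v x)\<^sup>2) \<partial>lebesgue_on D)"

definition L2_space :: "(real^'n) set \<Rightarrow> (real^'n \<Rightarrow> real) set" where
  "L2_space D = {v. v \<in> borel_measurable (lebesgue_on D) \<and> L2_enorm D v < \<infinity>}"

definition Hs_eseminorm :: "real \<Rightarrow> (real^'n) set \<Rightarrow> (real^'n \<Rightarrow> real) \<Rightarrow> ennreal" where
  "Hs_eseminorm s D v =
     esqrt (\<integral>\<^sup>+x. (\<integral>\<^sup>+y. ennreal ((v y - v x)\<^sup>2 / norm (y - x) powr (real CARD('n) + 2 * s))
       \<partial>lebesgue_on D) \<partial>lebesgue_on D)"

definition Hs_enorm :: "real \<Rightarrow> (real^'n) set \<Rightarrow> (real^'n \<Rightarrow> real) \<Rightarrow> ennreal" where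
  "Hs_enorm s D v = L2_enorm D v + Hs_eseminorm s D v"

definition Hs_space :: "real \<Rightarrow> (real^'n) set \<Rightarrow> (real^'n \<Rightarrow> real) set" where
  "Hs_space s D = {v \<in> L2_space D. Hs_enorm s D v < \<infinity>}"

definition Hs_zero_space :: "real \<Rightarrow> (real^'n) set \<Rightarrow> (real^'n \<Rightarrow> real) set" where
  "Hs_zero_space s \<Omega> = {w \<in> Hs_space s UNIV. AE x in lebesgue. x \<notin> \<Omega> \<longrightarrow> w x = 0}"

definition frac_const :: "nat \<Rightarrow> real \<Rightarrow> real" where
  "frac_const n s = s * 2 powr (2 * s) * Gamma ((real n + 2 * s) / 2) /
     (pi powr (real n / 2) * Gamma (1 - s))"

definition trunc_kernel :: "real \<Rightarrow> real \<Rightarrow> real^'n \<Rightarrow> real^'n \<Rightarrow> real" where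
  "trunc_kernel s \<delta> x y =
     (if y \<in> cball x \<delta>
      then frac_const CARD('n) s / (2 * norm (x - y) powr (real CARD('n) + 2 * s)) else 0)"

text \<open>In the following, \<open>D\<close> stands for the union of \<open>\<Omega>\<close> and its interaction domain.\<close>

definition energy_eseminorm :: "real \<Rightarrow> real \<Rightarrow> (real^'n) set \<Rightarrow> (real^'n \<Rightarrow> real) \<Rightarrow> ennreal" where
  "energy_eseminorm s \<delta> D v =
     esqrt (1 / 2 * (\<integral>\<^sup>+x. (\<integral>\<^sup>+y. ennreal ((v y - v x)\<^sup>2 * trunc_kernel s \<delta> x y)
       \<partial>lebesgue_on D) \<partial>lebesgue_on D))"

definition V_space :: "real \<Rightarrow> real \<Rightarrow> (real^'n) set \<Rightarrow> (real^'n \<Rightarrow> real) set" where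
  "V_space s \<delta> D = {v \<in> L2_space D. energy_eseminorm s \<delta> D v < \<infinity>}"

definition Vc_space :: "real \<Rightarrow> real \<Rightarrow> (real^'n) set \<Rightarrow> (real^'n \<Rightarrow> real) set" where
  "Vc_space s \<delta> \<Omega> =
     {v \<in> V_space s \<delta> (\<Omega> \<union> interaction_domain \<delta> \<Omega>).
        AE x in lebesgue. x \<in> interaction_domain \<delta> \<Omega> \<longrightarrow> v x = 0}"

section \<open>Weak problems\<close>

definition frac_form :: "real \<Rightarrow> (real^'n \<Rightarrow> real) \<Rightarrow> (real^'n \<Rightarrow> real) \<Rightarrow> real" where
  "frac_form s u v = frac_const CARD('n) s / 2 *
     (LINT x|lebesgue. LINT y|lebesgue.
        (u y - u x) / norm (x - y) powr (real CARD('n) + 2 * s) * (v y - v x))"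

definition trunc_form ::
    "real \<Rightarrow> real \<Rightarrow> (real^'n) set \<Rightarrow> (real^'n \<Rightarrow> real) \<Rightarrow> (real^'n \<Rightarrow> real) \<Rightarrow> real" where
  "trunc_form s \<delta> D u v = frac_const CARD('n) s / 2 *
     (LINT x|lebesgue_on D. LINT y|lebesgue_on (D \<inter> cball x \<delta>).
        (u y - u x) / norm (x - y) powr (real CARD('n) + 2 * s) * (v y - v x))"

definition frac_solution :: "real \<Rightarrow> (real^'n) set \<Rightarrow> (real^'n \<Rightarrow> real) \<Rightarrow> (real^'n \<Rightarrow> real) \<Rightarrow> bool" where
  "frac_solution s \<Omega> f u \<longleftrightarrow>
     u \<in> Hs_zero_space s \<Omega> \<and>
     (\<forall>v \<in> Hs_zero_space s \<Omega>. frac_form s u v = (LINT x|lebesgue_on \<Omega>. f x * v x))"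

definition trunc_solution ::
    "real \<Rightarrow> real \<Rightarrow> (real^'n) set \<Rightarrow> (real^'n \<Rightarrow> real) \<Rightarrow> (real^'n \<Rightarrow> real) \<Rightarrow> bool" where
  "trunc_solution s \<delta> \<Omega> f u \<longleftrightarrow>
     u \<in> Vc_space s \<delta> \<Omega> \<and>
     (\<forall>v \<in> Vc_space s \<delta> \<Omega>.
        trunc_form s \<delta> (\<Omega> \<union> interaction_domain \<delta> \<Omega>) u v = (LINT x|lebesgue_on \<Omega>. f x * v x))"

end

theory Submission
  imports Defs
begin

text \<open>The error \<open>w = u - ut\<close> is admissible in both weak problems.  Testing both with \<open>w\<close> expresses
  the energy of \<open>w\<close> by the interactions of \<open>u\<close> and \<open>w\<close> at distance larger than \<open>\<delta>\<close>, since a pair at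
  distance at most \<open>\<delta>\<close> that meets \<open>\<Omega>\<close> lies in \<open>D\<close>, the union of \<open>\<Omega>\<close> and its interaction domain.
  As \<open>\<delta>\<close> exceeds the diameter of \<open>\<Omega>\<close>, two points at distance larger than \<open>\<delta>\<close> are not both in \<open>\<Omega>\<close>, so
  the product of increments reduces to products of values.  The tail of the kernel integrates to a
  multiple of \<open>\<delta> powr (- 2 * s) / s\<close>, and Cauchy--Schwarz with the lower bound on the energy concludes.
  Since \<open>\<Omega>\<close> is open, \<open>D\<close> is open as well, hence measurable.\<close>

section \<open>Iterated integrals over the product of two Lebesgue measures\<close>

lemma sigma_finite_lebesgue: "sigma_finite_measure (lebesgue :: 'a::euclidean_space measure)"
proof
  \<comment> \<open>A countable cover by Borel sets of finite measure for \<open>lborel\<close>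
    serves the completion too, since both measures agree on Borel sets.\<close>
  obtain A :: "'a set set" where A: "countable A" "A \<subseteq> sets lborel" "\<Union>A = space lborel"
    "\<forall>a\<in>A. emeasure lborel a \<noteq> \<infinity>"
    using lborel.sigma_finite_countable by metis
  show "\<exists>A::'a set set. countable A \<and> A \<subseteq> sets lebesgue \<and> \<Union>A = space lebesgue \<and>
      (\<forall>a\<in>A. emeasure lebesgue a \<noteq> \<infinity>)"
    using A by (intro exI[of _ A]) (auto simp: emeasure_completion)
qed

interpretation lebesgue: sigma_finite_measure "lebesgue :: 'a::euclidean_space measure"
  by (rule sigma_finite_lebesgue)

interpretation lebesgue_pair: pair_sigma_finite
  "lebesgue :: 'a::euclidean_space measure" "lebesgue :: 'b::euclidean_space measure" ..

text \<open>The completion only adds measurable sets, so points and coordinates of pairs stay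
  measurable into \<open>borel\<close>. This suffices for the norms and differences from which the
  kernel is built.\<close>

lemma borel_measurable_id_lebesgue [measurable]:
  "(\<lambda>x. x) \<in> borel_measurable (lebesgue :: 'a::euclidean_space measure)"
  by (rule measurable_completion) simp

lemma borel_measurable_fst_lebesgue [measurable]:
  "fst \<in> (lebesgue \<Otimes>\<^sub>M N) \<rightarrow>\<^sub>M (borel :: 'a::euclidean_space measure)"
  by (rule measurable_compose[OF measurable_fst borel_measurable_id_lebesgue])

lemma borel_measurable_snd_lebesgue [measurable]:
  "snd \<in> (N \<Otimes>\<^sub>M lebesgue) \<rightarrow>\<^sub>M (borel :: 'a::euclidean_space measure)"
  by (rule measurable_compose[OF measurable_snd borel_measurable_id_lebesgue])

lemma UNIV_in_sets_lebesgue_pair [measurable, simp]: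
  "UNIV \<in> sets ((lebesgue :: 'a::euclidean_space measure) \<Otimes>\<^sub>M (lebesgue :: 'b::euclidean_space measure))"
  using sets.top[of "lebesgue \<Otimes>\<^sub>M lebesgue"] by (simp add: space_pair_measure)

text \<open>Tonelli for an inner domain that depends on the outer variable, as the ball around
  \<open>x\<close> does in \<open>trunc_form\<close>. The integrand \<open>f\<close> enters only
  through almost everywhere equality with the measurable \<open>g\<close>, so that functions known
  merely on \<open>D\<close> can be replaced by representatives on the whole space.\<close>

lemma nn_integral_Sigma_lebesgue:
  fixes g :: "'a::euclidean_space \<times> 'b::euclidean_space \<Rightarrow> ennreal"
  assumes D: "D \<in> sets lebesgue" and E: "Sigma D E \<in> sets (lebesgue \<Otimes>\<^sub>M lebesgue)"
    and g: "g \<in> borel_measurable (lebesgue \<Otimes>\<^sub>M lebesgue)"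
    and eq: "AE x in lebesgue. x \<in> D \<longrightarrow> (AE y in lebesgue. y \<in> E x \<longrightarrow> f x y = g (x, y))"
  shows "(\<integral>\<^sup>+x. (\<integral>\<^sup>+y. f x y \<partial>lebesgue_on (E x)) \<partial>lebesgue_on D) =
    (\<integral>\<^sup>+z. g z * indicator (Sigma D E) z \<partial>(lebesgue \<Otimes>\<^sub>M lebesgue))"
proof -
  have Ex: "E x \<in> sets lebesgue" if "x \<in> D" for x
    using sets_Pair1[OF E, of x] that by (simp add: Sigma_def vimage_def)
  have "(\<integral>\<^sup>+x. (\<integral>\<^sup>+y. f x y \<partial>lebesgue_on (E x)) \<partial>lebesgue_on D) =
      (\<integral>\<^sup>+x. (\<integral>\<^sup>+y. f x y \<partial>lebesgue_on (E x)) * indicator D x \<partial>lebesgue)"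
    using D by (simp add: nn_integral_restrict_space)
  also have "\<dots> = (\<integral>\<^sup>+x. (\<integral>\<^sup>+y. g (x, y) * indicator (Sigma D E) (x, y) \<partial>lebesgue) \<partial>lebesgue)"
  proof (rule nn_integral_cong_AE)
    show "AE x in lebesgue. (\<integral>\<^sup>+y. f x y \<partial>lebesgue_on (E x)) * indicator D x =
        (\<integral>\<^sup>+y. g (x, y) * indicator (Sigma D E) (x, y) \<partial>lebesgue)"
      using eq
    proof eventually_elim
      case (elim x)
      show ?case
      proof (cases "x \<in> D")
        case True
        have "(\<integral>\<^sup>+y. f x y \<partial>lebesgue_on (E x)) = (\<integral>\<^sup>+y. f x y * indicator (E x) y \<partial>lebesgue)"
          using Ex[OF True] by (simp add: nn_integral_restrict_space)
        also have "\<dots> = (\<integral>\<^sup>+y. g (x, y) * indicator (Sigma D E) (x, y) \<partial>lebesgue)"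
          using elim[rule_format, OF True]
          by (intro nn_integral_cong_AE) (auto elim!: eventually_mono simp: True split: split_indicator)
        finally show ?thesis using True by simp
      qed simp
    qed
  qed
  also have "\<dots> = (\<integral>\<^sup>+z. g z * indicator (Sigma D E) z \<partial>(lebesgue \<Otimes>\<^sub>M lebesgue))"
    using g E by (intro lebesgue.nn_integral_fst borel_measurable_times_ennreal borel_measurable_indicator)
  finally show ?thesis .
qed

text \<open>The Fubini counterpart for signed integrands. Bochner integrals of almost everywhere
  equal functions are compared through their measurability; that of \<open>f\<close> follows from
  that of \<open>g\<close> because \<open>lebesgue\<close> is complete, and that of the partial
  integrals is part of Fubini's theorem.\<close>

lemma integral_Sigma_lebesgue:
  fixes g :: "'a::euclidean_space \<times> 'b::euclidean_space \<Rightarrow> real"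
  assumes D: "D \<in> sets lebesgue" and E: "Sigma D E \<in> sets (lebesgue \<Otimes>\<^sub>M lebesgue)"
    and g: "integrable (lebesgue \<Otimes>\<^sub>M lebesgue) (\<lambda>z. indicator (Sigma D E) z * g z)"
    and gm: "g \<in> borel_measurable (lebesgue \<Otimes>\<^sub>M lebesgue)"
    and eq: "AE x in lebesgue. x \<in> D \<longrightarrow> (AE y in lebesgue. y \<in> E x \<longrightarrow> f x y = g (x, y))"
  shows "(LINT x|lebesgue_on D. LINT y|lebesgue_on (E x). f x y) =
    (LINT z|(lebesgue \<Otimes>\<^sub>M lebesgue). indicator (Sigma D E) z * g z)"
proof -
  have Ex: "E x \<in> sets lebesgue" if "x \<in> D" for x
    using sets_Pair1[OF E, of x] that by (simp add: Sigma_def vimage_def)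
  have restrict: "(LINT x|lebesgue_on S. h x) = (LINT x|lebesgue. indicator S x * h x)"
    if "S \<in> sets lebesgue" for S :: "'c::euclidean_space set" and h :: "'c \<Rightarrow> real"
    using that by (simp add: integral_restrict_space)
  have inner: "(LINT y|lebesgue_on (E x). f x y) =
      (LINT y|lebesgue. indicator (Sigma D E) (x, y) * g (x, y))"
    if x: "x \<in> D" and ae: "AE y in lebesgue. y \<in> E x \<longrightarrow> f x y = g (x, y)" for x
  proof -
    have *: "(\<lambda>y. g (x, y)) \<in> borel_measurable lebesgue"
      by (rule measurable_compose_Pair1[OF _ gm]) simp
    have "(LINT y|lebesgue_on (E x). f x y) = (LINT y|lebesgue. indicator (E x) y * f x y)"
      by (rule restrict[OF Ex[OF x]])
    also have "\<dots> = (LINT y|lebesgue. indicator (Sigma D E) (x, y) * g (x, y))"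
    proof (rule integral_cong_AE)
      show g1: "(\<lambda>y. indicator (Sigma D E) (x, y) * g (x, y)) \<in> borel_measurable lebesgue"
        using * Ex[OF x] x by (simp add: indicator_def)
      have ae2: "AE y in lebesgue. indicator (Sigma D E) (x, y) * g (x, y) = indicator (E x) y * f x y"
        using ae x by (auto elim!: eventually_mono split: split_indicator)
      show "AE y in lebesgue. indicator (E x) y * f x y = indicator (Sigma D E) (x, y) * g (x, y)"
        using ae2 by (auto elim!: eventually_mono)
      show "(\<lambda>y. indicator (E x) y * f x y) \<in> borel_measurable lebesgue"
        using borel_measurable_AE[OF g1 ae2] .
    qed
    finally show ?thesis .
  qed
  let ?h = "\<lambda>x. LINT y|lebesgue. indicator (Sigma D E) (x, y) * g (x, y)"
  have hm: "?h \<in> borel_measurable lebesgue"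
    using lebesgue_pair.integrable_fst'[OF g] by simp
  have ae: "AE x in lebesgue. ?h x = indicator D x * (LINT y|lebesgue_on (E x). f x y)"
    using eq by eventually_elim (auto simp: inner split: split_indicator)
  have "(LINT x|lebesgue_on D. LINT y|lebesgue_on (E x). f x y) =
      (LINT x|lebesgue. indicator D x * (LINT y|lebesgue_on (E x). f x y))"
    by (rule restrict[OF D])
  also have "\<dots> = (LINT x|lebesgue. ?h x)"
    using ae by (intro integral_cong_AE borel_measurable_AE[OF hm ae] hm) (auto elim!: eventually_mono)
  also have "\<dots> = (LINT z|(lebesgue \<Otimes>\<^sub>M lebesgue). indicator (Sigma D E) z * g z)"
    by (rule lebesgue_pair.integral_fst'[OF g])
  finally show ?thesis .
qed

section \<open>The kernel\<close>

definition riesz_kernel :: "real \<Rightarrow> (real^'n) \<times> (real^'n) \<Rightarrow> real" where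
  "riesz_kernel s z = 1 / norm (fst z - snd z) powr (real CARD('n) + 2 * s)"

text \<open>The strict inequality makes the section at \<open>x\<close> the complement of
  \<open>cball x \<delta>\<close>, the ball that cuts off the truncated kernel.\<close>

definition tail :: "real \<Rightarrow> ((real^'n) \<times> (real^'n)) set" where
  "tail \<delta> = {z. \<delta> < norm (fst z - snd z)}"

lemma riesz_kernel_nonneg [simp]: "0 \<le> riesz_kernel s z"
  by (simp add: riesz_kernel_def)

lemma borel_measurable_riesz_kernel [measurable]:
  "riesz_kernel s \<in> borel_measurable (lebesgue \<Otimes>\<^sub>M lebesgue)"
  unfolding riesz_kernel_def[abs_def] by measurable

lemma sets_tail [measurable]: "tail \<delta> \<in> sets (lebesgue \<Otimes>\<^sub>M lebesgue)"
proof -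
  have "{z \<in> space (lebesgue \<Otimes>\<^sub>M lebesgue). \<delta> < norm (fst z - snd z :: real^'n)}
      \<in> sets (lebesgue \<Otimes>\<^sub>M lebesgue)"
    by measurable
  then show ?thesis by (simp add: tail_def space_pair_measure)
qed

lemma nn_integral_powr_atLeast:
  fixes a \<delta> :: real
  assumes "0 < a" "0 < \<delta>"
  shows "(\<integral>\<^sup>+t. ennreal (t powr (- a - 1)) * indicator {\<delta>..} t \<partial>lborel) = ennreal (\<delta> powr (- a) / a)"
proof -
  have "((\<lambda>t. - (t powr (- a) / a)) \<longlongrightarrow> - (0 / a)) at_top"
    using assms by (intro tendsto_intros tendsto_neg_powr filterlim_ident) auto
  moreover have "((\<lambda>t. - (t powr (- a) / a)) has_real_derivative t powr (- a - 1)) (at t)"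
    if "\<delta> \<le> t" for t
    using assms that by (auto intro!: derivative_eq_intros)
  ultimately have "(\<integral>\<^sup>+t. ennreal (t powr (- a - 1)) * indicator {\<delta>..} t \<partial>lborel) =
      ennreal (0 - - (\<delta> powr (- a) / a))"
    by (intro nn_integral_FTC_atLeast) auto
  then show ?thesis by simp
qed

text \<open>Writing \<open>r powr - a\<close> as an integral of \<open>t powr (- a - 1)\<close> over \<open>t \<ge> r\<close> reduces the
  bound to the volume of balls and avoids polar coordinates.\<close>

lemma nn_integral_riesz_kernel_tail:
  fixes x :: "real^'n"
  assumes s: "0 < s" "s < 1" and \<delta>: "0 < \<delta>"
  shows "(\<integral>\<^sup>+y. ennreal (riesz_kernel s (x, y)) * indicator (tail \<delta>) (x, y) \<partial>lebesgue) \<le>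
    ennreal ((real CARD('n) + 2) * unit_ball_vol (real CARD('n)) / (2 * s) * \<delta> powr (- 2 * s))"
proof -
  define n where "n = real CARD('n)"
  define V where "V = unit_ball_vol n"
  define a where "a = n + 2 * s"
  have n0: "0 < n" and V0: "0 \<le> V" and a: "0 < a" "a \<le> n + 2"
    using s by (auto simp: n_def V_def a_def)
  \<comment> \<open>A point \<open>y\<close> at distance \<open>r\<close> from \<open>x\<close> lies
    in \<open>cball x t\<close> exactly when \<open>t \<ge> r\<close>. As
    \<open>r > \<delta>\<close> on the tail, the indicator of the ball lets the integral over
    \<open>t \<ge> r\<close> be written over all \<open>t \<ge> \<delta>\<close>.\<close>
  have layer: "ennreal (riesz_kernel s (x, y)) * indicator (tail \<delta>) (x, y) \<le>
      ennreal a * (\<integral>\<^sup>+t. ennreal (t powr (- a - 1)) * indicator {\<delta>..} t * indicator (cball x t) y \<partial>lborel)" for y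
  proof (cases "(x, y) \<in> tail \<delta>")
    case True
    define r where "r = norm (x - y)"
    have r: "\<delta> < r" "0 < r" using True \<delta> by (auto simp: tail_def r_def)
    have "riesz_kernel s (x, y) = r powr (- a)"
      by (subst powr_minus_divide) (simp add: riesz_kernel_def r_def a_def n_def)
    then have "ennreal (riesz_kernel s (x, y)) * indicator (tail \<delta>) (x, y) = ennreal a * ennreal (r powr (- a) / a)"
      using True a by (simp flip: ennreal_mult)
    also have "ennreal (r powr (- a) / a) = (\<integral>\<^sup>+t. ennreal (t powr (- a - 1)) * indicator {r..} t \<partial>lborel)"
      using nn_integral_powr_atLeast[OF a(1) r(2)] by simp
    also have "\<dots> \<le> (\<integral>\<^sup>+t. ennreal (t powr (- a - 1)) * indicator {\<delta>..} t * indicator (cball x t) y \<partial>lborel)"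
      using r by (intro nn_integral_mono) (auto simp: r_def dist_norm split: split_indicator)
    finally show ?thesis by (simp add: mult_left_mono)
  qed simp
  \<comment> \<open>The integrand is Borel, so the integrals over \<open>y\<close> and
    \<open>t\<close> can be exchanged for the Borel measures.\<close>
  have "(\<integral>\<^sup>+y. ennreal (riesz_kernel s (x, y)) * indicator (tail \<delta>) (x, y) \<partial>lebesgue) =
      (\<integral>\<^sup>+y. ennreal (riesz_kernel s (x, y)) * indicator (tail \<delta>) (x, y) \<partial>lborel)"
    by (rule nn_integral_completion)
  also have "\<dots> \<le> (\<integral>\<^sup>+y. ennreal a * (\<integral>\<^sup>+t. ennreal (t powr (- a - 1)) * indicator {\<delta>..} t *
      indicator (cball x t) y \<partial>lborel) \<partial>lborel)"
    by (intro nn_integral_mono layer)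
  also have "\<dots> = ennreal a * (\<integral>\<^sup>+y. (\<integral>\<^sup>+t. ennreal (t powr (- a - 1)) * indicator {\<delta>..} t *
      indicator (cball x t) y \<partial>lborel) \<partial>lborel)"
    unfolding mem_cball indicator_def by (intro nn_integral_cmult) measurable
  also have "(\<integral>\<^sup>+y. (\<integral>\<^sup>+t. ennreal (t powr (- a - 1)) * indicator {\<delta>..} t *
      indicator (cball x t) y \<partial>lborel) \<partial>lborel) =
      (\<integral>\<^sup>+t. (\<integral>\<^sup>+y. ennreal (t powr (- a - 1)) * indicator {\<delta>..} t *
      indicator (cball x t) y \<partial>lborel) \<partial>lborel)"
    unfolding mem_cball indicator_def by (rule lborel_pair.Fubini') measurable
  also have "\<dots> = (\<integral>\<^sup>+t. ennreal V * (ennreal (t powr (- (2 * s) - 1)) * indicator {\<delta>..} t) \<partial>lborel)"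
  proof (rule nn_integral_cong)
    fix t :: real
    show "(\<integral>\<^sup>+y. ennreal (t powr (- a - 1)) * indicator {\<delta>..} t * indicator (cball x t) y \<partial>lborel) =
        ennreal V * (ennreal (t powr (- (2 * s) - 1)) * indicator {\<delta>..} t)"
    proof (cases "\<delta> \<le> t")
      case True
      then have t: "0 < t" using \<delta> by simp
      \<comment> \<open>The volume of the ball raises the exponent from \<open>- a - 1\<close> to
        \<open>- (2 * s) - 1\<close>, which is still integrable at infinity because \<open>s\<close>
        is positive.\<close>
      have "t powr (- a - 1) * t ^ CARD('n) = t powr (- (2 * s) - 1)"
        using t by (simp add: a_def n_def flip: powr_realpow powr_add)
      moreover have "(\<integral>\<^sup>+y. ennreal (t powr (- a - 1)) * indicator (cball x t) y \<partial>lborel) =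
          ennreal (t powr (- a - 1)) * ennreal (V * t ^ CARD('n))"
        using t by (subst nn_integral_cmult) (auto simp: emeasure_cball V_def n_def intro!: borel_measurable_indicator)
      ultimately show ?thesis
        using True t V0 by (simp add: mult_ac flip: ennreal_mult)
    qed simp
  qed
  also have "\<dots> = ennreal V * ennreal (\<delta> powr (- (2 * s)) / (2 * s))"
    using nn_integral_powr_atLeast[of "2 * s" \<delta>] s \<delta> by (subst nn_integral_cmult) auto
  also have "ennreal a * \<dots> = ennreal (a * V / (2 * s) * \<delta> powr (- 2 * s))"
    using a V0 s by (simp add: mult_ac flip: ennreal_mult)
  \<comment> \<open>Since \<open>s < 1\<close>, the factor \<open>a = n + 2 * s\<close> is bounded
    by a number determined by the dimension; only \<open>1 / s\<close> and the power of
    \<open>\<delta>\<close> keep their dependence on \<open>s\<close>.\<close>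
  also have "\<dots> \<le> ennreal ((n + 2) * V / (2 * s) * \<delta> powr (- 2 * s))"
    using a V0 s by (intro ennreal_leI mult_right_mono divide_right_mono) auto
  finally show ?thesis by (simp add: n_def V_def)
qed

text \<open>Tonelli integrates out the variable on which \<open>g\<close> does not depend, which
  costs the tail bound. By symmetry of the kernel both summands contribute equally, hence the factor
  2. The lemma serves squares \<open>g = w^2\<close> as well as absolute values of products.\<close>

lemma nn_integral_riesz_kernel_tail_add:
  fixes g :: "real^'n \<Rightarrow> ennreal"
  assumes s: "0 < s" "s < 1" and \<delta>: "0 < \<delta>" and [measurable]: "g \<in> borel_measurable lebesgue"
  shows "(\<integral>\<^sup>+z. ennreal (riesz_kernel s z) * indicator (tail \<delta>) z * (g (fst z) + g (snd z))
      \<partial>(lebesgue \<Otimes>\<^sub>M lebesgue)) \<le>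
    2 * ennreal ((real CARD('n) + 2) * unit_ball_vol (real CARD('n)) / (2 * s) * \<delta> powr (- 2 * s)) *
      (\<integral>\<^sup>+x. g x \<partial>lebesgue)"
    (is "_ \<le> 2 * ?T * _")
proof -
  define k :: "(real^'n) \<times> (real^'n) \<Rightarrow> ennreal"
    where "k z = ennreal (riesz_kernel s z) * indicator (tail \<delta>) z" for z
  have [measurable]: "k \<in> borel_measurable (lebesgue \<Otimes>\<^sub>M lebesgue)"
    unfolding k_def[abs_def] by measurable
  have kT: "(\<integral>\<^sup>+y. k (x, y) \<partial>lebesgue) \<le> ?T" for x
    unfolding k_def by (rule nn_integral_riesz_kernel_tail[OF s \<delta>])
  have k_sym: "k (y, x) = k (x, y)" for x y
    by (simp add: k_def riesz_kernel_def tail_def norm_minus_commute indicator_def)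
  have [measurable]: "(\<lambda>y. k (x, y)) \<in> borel_measurable lebesgue" for x
    by (rule measurable_compose_Pair1[of _ lebesgue]) auto
  have "(\<integral>\<^sup>+z. k z * g (fst z) \<partial>(lebesgue \<Otimes>\<^sub>M lebesgue)) =
      (\<integral>\<^sup>+x. \<integral>\<^sup>+y. k (x, y) * g (fst (x, y)) \<partial>lebesgue \<partial>lebesgue)"
    by (rule lebesgue.nn_integral_fst[symmetric]) measurable
  also have "\<dots> = (\<integral>\<^sup>+x. (\<integral>\<^sup>+y. k (x, y) \<partial>lebesgue) * g x \<partial>lebesgue)"
    by (simp add: nn_integral_multc)
  finally have 1: "(\<integral>\<^sup>+z. k z * g (fst z) \<partial>(lebesgue \<Otimes>\<^sub>M lebesgue)) =
      (\<integral>\<^sup>+x. (\<integral>\<^sup>+y. k (x, y) \<partial>lebesgue) * g x \<partial>lebesgue)" .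
  have "(\<integral>\<^sup>+z. k z * g (snd z) \<partial>(lebesgue \<Otimes>\<^sub>M lebesgue)) =
      (\<integral>\<^sup>+y. \<integral>\<^sup>+x. k (x, y) * g (snd (x, y)) \<partial>lebesgue \<partial>lebesgue)"
    by (rule lebesgue_pair.nn_integral_snd[symmetric]) measurable
  also have "\<dots> = (\<integral>\<^sup>+y. (\<integral>\<^sup>+x. k (y, x) \<partial>lebesgue) * g y \<partial>lebesgue)"
    by (subst k_sym) (simp add: nn_integral_multc)
  finally have 2: "(\<integral>\<^sup>+z. k z * g (snd z) \<partial>(lebesgue \<Otimes>\<^sub>M lebesgue)) =
      (\<integral>\<^sup>+x. (\<integral>\<^sup>+y. k (x, y) \<partial>lebesgue) * g x \<partial>lebesgue)" .
  have le: "(\<integral>\<^sup>+x. (\<integral>\<^sup>+y. k (x, y) \<partial>lebesgue) * g x \<partial>lebesgue) \<le> ?T * (\<integral>\<^sup>+x. g x \<partial>lebesgue)"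
    by (subst nn_integral_cmult[symmetric], simp) (intro nn_integral_mono mult_right_mono kT zero_le)
  have "(\<integral>\<^sup>+z. k z * (g (fst z) + g (snd z)) \<partial>(lebesgue \<Otimes>\<^sub>M lebesgue)) =
      (\<integral>\<^sup>+z. k z * g (fst z) \<partial>(lebesgue \<Otimes>\<^sub>M lebesgue)) + (\<integral>\<^sup>+z. k z * g (snd z) \<partial>(lebesgue \<Otimes>\<^sub>M lebesgue))"
    unfolding distrib_left by (rule nn_integral_add) measurable
  also have "\<dots> \<le> ?T * (\<integral>\<^sup>+x. g x \<partial>lebesgue) + ?T * (\<integral>\<^sup>+x. g x \<partial>lebesgue)"
    unfolding 1 2 by (intro add_mono le)
  also have "\<dots> = 2 * ?T * (\<integral>\<^sup>+x. g x \<partial>lebesgue)"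
    by (simp only: mult_2[of ?T] distrib_right[of ?T ?T])
  finally show ?thesis unfolding k_def .
qed

section \<open>Energy and pairing\<close>

definition increment :: "(real^'n \<Rightarrow> real) \<Rightarrow> (real^'n) \<times> (real^'n) \<Rightarrow> real" where
  "increment v z = v (snd z) - v (fst z)"

text \<open>With the set of pairs as a parameter, one notion covers the squared seminorm on the
  whole space, the one on \<open>D \<times> D\<close>, and, up to a constant, the truncated
  energy.\<close>

definition energy :: "real \<Rightarrow> ((real^'n) \<times> (real^'n)) set \<Rightarrow> (real^'n \<Rightarrow> real) \<Rightarrow> ennreal" where
  "energy s E v =
     (\<integral>\<^sup>+z. ennreal (riesz_kernel s z * (increment v z)\<^sup>2) * indicator E z \<partial>(lebesgue \<Otimes>\<^sub>M lebesgue))"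

definition pairing_density :: "real \<Rightarrow> (real^'n \<Rightarrow> real) \<Rightarrow> (real^'n \<Rightarrow> real) \<Rightarrow> (real^'n) \<times> (real^'n) \<Rightarrow> real" where
  "pairing_density s a b z = riesz_kernel s z * (increment a z * increment b z)"

definition pairing ::
    "real \<Rightarrow> ((real^'n) \<times> (real^'n)) set \<Rightarrow> (real^'n \<Rightarrow> real) \<Rightarrow> (real^'n \<Rightarrow> real) \<Rightarrow> real" where
  "pairing s E a b = (LINT z|(lebesgue \<Otimes>\<^sub>M lebesgue). indicator E z * pairing_density s a b z)"

lemma borel_measurable_increment [measurable]:
  assumes [measurable]: "v \<in> borel_measurable lebesgue"
  shows "increment v \<in> borel_measurable (lebesgue \<Otimes>\<^sub>M lebesgue)"
  unfolding increment_def[abs_def] by measurable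

lemma borel_measurable_pairing_density [measurable]:
  assumes [measurable]: "a \<in> borel_measurable lebesgue" "b \<in> borel_measurable lebesgue"
  shows "pairing_density s a b \<in> borel_measurable (lebesgue \<Otimes>\<^sub>M lebesgue)"
  unfolding pairing_density_def[abs_def] by measurable

text \<open>Young's inequality for the product of increments dominates the density by the sum of the
  two energy densities. Finite energies thus ensure that \<open>pairing\<close> is a genuine
  integral and not a default value.\<close>

lemma integrable_pairing:
  assumes [measurable]: "a \<in> borel_measurable lebesgue" "b \<in> borel_measurable lebesgue"
    "E \<in> sets (lebesgue \<Otimes>\<^sub>M lebesgue)"
    and fin: "energy s E a < \<infinity>" "energy s E b < \<infinity>"
  shows "integrable (lebesgue \<Otimes>\<^sub>M lebesgue) (\<lambda>z. indicator E z * pairing_density s a b z)"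
proof (rule integrableI_bounded)
  have "2 * \<bar>p * q\<bar> \<le> p\<^sup>2 + q\<^sup>2" for p q :: real
    using sum_squares_bound[of "\<bar>p\<bar>" "\<bar>q\<bar>"] by (simp add: abs_mult)
  then have "\<bar>p * q\<bar> \<le> p\<^sup>2 + q\<^sup>2" for p q :: real
    by (smt (verit) abs_ge_zero)
  then have *: "riesz_kernel s z * \<bar>increment a z * increment b z\<bar> \<le>
      riesz_kernel s z * (increment a z)\<^sup>2 + riesz_kernel s z * (increment b z)\<^sup>2" for z
    by (simp add: mult_left_mono flip: distrib_left)
  have "(\<integral>\<^sup>+z. ennreal (norm (indicator E z * pairing_density s a b z)) \<partial>(lebesgue \<Otimes>\<^sub>M lebesgue)) \<le>
      (\<integral>\<^sup>+z. ennreal (riesz_kernel s z * (increment a z)\<^sup>2) * indicator E z +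
        ennreal (riesz_kernel s z * (increment b z)\<^sup>2) * indicator E z \<partial>(lebesgue \<Otimes>\<^sub>M lebesgue))"
    using * by (intro nn_integral_mono)
      (auto simp: pairing_density_def abs_mult simp flip: ennreal_plus split: split_indicator intro!: ennreal_leI)
  also have "\<dots> = energy s E a + energy s E b"
    unfolding energy_def by (rule nn_integral_add) measurable
  also have "\<dots> < \<infinity>" using fin by simp
  finally show "(\<integral>\<^sup>+z. ennreal (norm (indicator E z * pairing_density s a b z)) \<partial>(lebesgue \<Otimes>\<^sub>M lebesgue)) < \<infinity>" .
qed simp

lemma energy_mono:
  assumes "E \<subseteq> F"
  shows "energy s E v \<le> energy s F v"
  unfolding energy_def using assms
  by (intro nn_integral_mono mult_left_mono) (auto simp: indicator_def)

lemma energy_diff_less_top: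
  assumes [measurable]: "a \<in> borel_measurable lebesgue" "b \<in> borel_measurable lebesgue"
    "E \<in> sets (lebesgue \<Otimes>\<^sub>M lebesgue)"
    and fin: "energy s E a < \<infinity>" "energy s E b < \<infinity>"
  shows "energy s E (\<lambda>x. a x - b x) < \<infinity>"
proof -
  have "(p - q)\<^sup>2 \<le> 2 * (p\<^sup>2 + q\<^sup>2)" for p q :: real
    using zero_le_power2[of "p + q"] by (simp add: power2_eq_square algebra_simps)
  then have *: "(increment (\<lambda>x. a x - b x) z)\<^sup>2 \<le> 2 * ((increment a z)\<^sup>2 + (increment b z)\<^sup>2)" for z
    by (simp add: increment_def algebra_simps) (smt (verit))
  have "riesz_kernel s z * (increment (\<lambda>x. a x - b x) z)\<^sup>2 \<le>
      2 * (riesz_kernel s z * (increment a z)\<^sup>2 + riesz_kernel s z * (increment b z)\<^sup>2)" for z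
    using mult_left_mono[OF *[of z] riesz_kernel_nonneg[of s z]] by (simp add: algebra_simps)
  then have "energy s E (\<lambda>x. a x - b x) \<le>
      (\<integral>\<^sup>+z. 2 * (ennreal (riesz_kernel s z * (increment a z)\<^sup>2) * indicator E z +
        ennreal (riesz_kernel s z * (increment b z)\<^sup>2) * indicator E z) \<partial>(lebesgue \<Otimes>\<^sub>M lebesgue))"
    unfolding energy_def
    by (intro nn_integral_mono) (auto split: split_indicator simp flip: ennreal_plus ennreal_numeral ennreal_mult intro!: ennreal_leI)
  also have "\<dots> = 2 * (energy s E a + energy s E b)"
    unfolding energy_def by (subst nn_integral_cmult, measurable, subst nn_integral_add) auto
  also have "\<dots> < \<infinity>" using fin by (simp add: ennreal_mult_less_top)
  finally show ?thesis .
qed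

lemma pairing_diff_left:
  assumes "integrable (lebesgue \<Otimes>\<^sub>M lebesgue) (\<lambda>z. indicator E z * pairing_density s a w z)"
    and "integrable (lebesgue \<Otimes>\<^sub>M lebesgue) (\<lambda>z. indicator E z * pairing_density s b w z)"
  shows "pairing s E (\<lambda>x. a x - b x) w = pairing s E a w - pairing s E b w"
proof -
  have "indicator E z * pairing_density s (\<lambda>x. a x - b x) w z =
      indicator E z * pairing_density s a w z - indicator E z * pairing_density s b w z" for z
    unfolding pairing_density_def increment_def by algebra
  then show ?thesis
    unfolding pairing_def by (simp only: Bochner_Integration.integral_diff[OF assms])
qed

text \<open>The passage from \<open>[0, \<infinity>]\<close> to the reals; at infinite energy the
  Bochner integral would have the default value 0.\<close>

lemma energy_eq_pairing:
  assumes [measurable]: "a \<in> borel_measurable lebesgue" "E \<in> sets (lebesgue \<Otimes>\<^sub>M lebesgue)"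
    and fin: "energy s E a < \<infinity>"
  shows "energy s E a = ennreal (pairing s E a a)"
proof -
  have "energy s E a = (\<integral>\<^sup>+z. ennreal (indicator E z * pairing_density s a a z) \<partial>(lebesgue \<Otimes>\<^sub>M lebesgue))"
    unfolding energy_def pairing_density_def
    by (intro nn_integral_cong) (auto simp: power2_eq_square split: split_indicator)
  also have "\<dots> = ennreal (pairing s E a a)"
    unfolding pairing_def using fin
    by (intro nn_integral_eq_integral integrable_pairing) (auto simp: pairing_density_def)
  finally show ?thesis .
qed

section \<open>Geometry and constants\<close>

text \<open>Closed balls may be replaced by open ones because \<open>\<Omega>\<close> is open: a
  centre \<open>x\<close> can be moved slightly towards \<open>y\<close> without leaving
  \<open>\<Omega>\<close>, and the distance drops strictly below \<open>\<delta>\<close>. This is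
  the source of openness and measurability of the union.\<close>

lemma Un_interaction_domain:
  fixes \<Omega> :: "(real^'n) set"
  assumes "open \<Omega>" "0 < \<delta>"
  shows "\<Omega> \<union> interaction_domain \<delta> \<Omega> = (\<Union>x\<in>\<Omega>. ball x \<delta>)"
proof (intro equalityI subsetI)
  fix y assume y: "y \<in> \<Omega> \<union> interaction_domain \<delta> \<Omega>"
  show "y \<in> (\<Union>x\<in>\<Omega>. ball x \<delta>)"
  proof (cases "y \<in> \<Omega>")
    case True
    then show ?thesis using \<open>0 < \<delta>\<close> by (intro UN_I[of y]) auto
  next
    case False
    then obtain x where x: "x \<in> \<Omega>" "norm (x - y) \<le> \<delta>" "x \<noteq> y"
      using y by (auto simp: interaction_domain_def)
    obtain e where e: "0 < e" "ball x e \<subseteq> \<Omega>"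
      using \<open>open \<Omega>\<close> x(1) open_contains_ball by blast
    define r where "r = norm (x - y)"
    have r: "0 < r" "r \<le> \<delta>" using x by (auto simp: r_def)
    \<comment> \<open>The bound by \<open>e / (2 * r)\<close> keeps the shifted centre in the ball
      of radius \<open>e\<close> inside \<open>\<Omega>\<close>; the bound by \<open>1 / 2\<close>
      keeps it short of \<open>y\<close>.\<close>
    define t where "t = min (1 / 2) (e / (2 * r))"
    have t: "0 < t" "t < 1" using r e by (auto simp: t_def)
    have "t * r \<le> e / (2 * r) * r"
      using r by (intro mult_right_mono) (auto simp: t_def)
    then have tr: "t * r < e" using r e by simp
    define x' where "x' = x + t *\<^sub>R (y - x)"
    have "dist x x' = t * r"
      using t by (simp add: x'_def r_def dist_norm norm_minus_commute)
    then have "x' \<in> \<Omega>" using tr e by auto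
    moreover have "x' - y = (1 - t) *\<^sub>R (x - y)"
      by (simp add: x'_def algebra_simps)
    then have "dist x' y = (1 - t) * r"
      using t by (simp add: dist_norm r_def)
    then have "dist x' y < r" using t r by simp
    ultimately show ?thesis using r by (intro UN_I[of x']) auto
  qed
next
  fix y assume "y \<in> (\<Union>x\<in>\<Omega>. ball x \<delta>)"
  then show "y \<in> \<Omega> \<union> interaction_domain \<delta> \<Omega>"
    by (force simp: interaction_domain_def dist_norm)
qed

lemma open_Un_interaction_domain:
  assumes "open \<Omega>" "0 < \<delta>"
  shows "open (\<Omega> \<union> interaction_domain \<delta> \<Omega>)"
  unfolding Un_interaction_domain[OF assms] by auto

text \<open>Containment in every ball centred in \<open>\<Omega>\<close> says that \<open>R\<close>
  bounds all mutual distances. Boundedness makes the diameter such an \<open>R\<close>, and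
  nonemptiness rules out smaller, even negative, values.\<close>

lemma covering_radius_eq_diameter:
  assumes "bounded \<Omega>" "\<Omega> \<noteq> {}"
  shows "covering_radius \<Omega> = diameter \<Omega>"
  unfolding covering_radius_def
proof (rule Least_equality)
  show "\<forall>x\<in>\<Omega>. \<Omega> \<subseteq> cball x (diameter \<Omega>)"
    using assms(1) by (auto intro: diameter_bounded_bound)
  fix R assume R: "\<forall>x\<in>\<Omega>. \<Omega> \<subseteq> cball x R"
  have "norm (x - y) \<le> R" if "x \<in> \<Omega>" "y \<in> \<Omega>" for x y
    using subsetD[OF bspec[OF R that(1)] that(2)] by (simp add: dist_norm)
  then show "diameter \<Omega> \<le> R"
    using assms(2) by (intro diameter_le) auto
qed

text \<open>The pole of \<open>Gamma (1 - s)\<close> at \<open>s = 1\<close> is a zero of the entire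
  function \<open>rGamma\<close>, so the constant extends continuously to the compact interval
  \<open>{0..1}\<close> and is bounded there. This makes the final constant independent of
  \<open>s\<close>.\<close>

lemma frac_const_bounds:
  assumes "0 < n"
  obtains B where "0 < B" "\<And>s. \<lbrakk>0 < s; s < 1\<rbrakk> \<Longrightarrow> 0 < frac_const n s \<and> frac_const n s \<le> B"
proof -
  define g where "g = (\<lambda>s::real. s * 2 powr (2 * s) * Gamma ((real n + 2 * s) / 2) * rGamma (1 - s) / pi powr (real n / 2))"
  have frac: "frac_const n s = g s" for s
    unfolding frac_const_def g_def rGamma_inverse_Gamma by (simp only: divide_inverse inverse_mult_distrib mult_ac)
  \<comment> \<open>Positive dimension keeps the argument of \<open>Gamma\<close> away from the
    poles, even at \<open>s = 0\<close>.\<close>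
  have "(real n + 2 * s) / 2 \<notin> \<int>\<^sub>\<le>\<^sub>0" if "0 \<le> s" for s
    using that assms by (intro notI) (auto dest!: nonpos_Ints_nonpos)
  then have Gc: "continuous_on {0..1} (\<lambda>s. Gamma ((real n + 2 * s) / 2))"
    by (intro continuous_on_compose2[OF continuous_on_Gamma[of "- \<int>\<^sub>\<le>\<^sub>0"]] continuous_intros) auto
  have "continuous_on {0..1} g"
    unfolding g_def
    by (intro continuous_intros Gc continuous_on_compose2[OF continuous_on_rGamma[of UNIV]]) auto
  then have "bounded (g ` {0..1})"
    by (intro compact_imp_bounded compact_continuous_image) auto
  then obtain b where "\<forall>x\<in>g ` {0..1}. \<bar>x\<bar> \<le> b"
    unfolding bounded_real by blast
  then have b: "\<bar>g s\<bar> \<le> b" if "0 \<le> s" "s \<le> 1" for s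
    using that by (simp add: image_iff)
  show ?thesis
  proof
    show "0 < max 1 b" by simp
    fix s :: real assume s: "0 < s" "s < 1"
    have "0 < Gamma ((real n + 2 * s) / 2)" "0 < Gamma (1 - s)"
      using s by (intro Gamma_real_pos; simp)+
    then have "0 < frac_const n s"
      unfolding frac_const_def using s by simp
    then show "0 < frac_const n s \<and> frac_const n s \<le> max 1 b"
      using b[of s] s by (simp add: frac)
  qed
qed

section \<open>Norms and forms in terms of energy and pairing\<close>

text \<open>The dependent product matches the nested integration domain of
  \<open>trunc_form\<close>; measurability is read off from the description in
  \<open>near_eq\<close>.\<close>

definition near :: "real \<Rightarrow> (real^'n) set \<Rightarrow> ((real^'n) \<times> (real^'n)) set" where
  "near \<delta> D = Sigma D (\<lambda>x. D \<inter> cball x \<delta>)"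

lemma near_eq: "near \<delta> D = D \<times> D - tail \<delta>"
  by (auto simp: near_def tail_def dist_norm)

lemma sets_near:
  assumes "D \<in> sets lebesgue"
  shows "near \<delta> D \<in> sets (lebesgue \<Otimes>\<^sub>M lebesgue)"
  unfolding near_eq using assms by (intro sets.Diff sets_tail) auto

lemma L2_enorm_cong_AE:
  assumes S: "S \<in> sets lebesgue" and ae: "AE x in lebesgue. x \<in> S \<longrightarrow> v x = w x"
  shows "L2_enorm S v = L2_enorm S w"
proof -
  have "AE x in lebesgue_on S. v x = w x"
    using ae S by (simp add: AE_restrict_space_iff)
  then have "(\<integral>\<^sup>+x. ennreal ((v x)\<^sup>2) \<partial>lebesgue_on S) = (\<integral>\<^sup>+x. ennreal ((w x)\<^sup>2) \<partial>lebesgue_on S)"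
    by (intro nn_integral_cong_AE) (auto elim: eventually_mono)
  then show ?thesis by (simp add: L2_enorm_def)
qed

lemma L2_enorm_eq_UNIV:
  assumes S: "S \<in> sets lebesgue" and zero: "\<And>x. x \<notin> S \<Longrightarrow> w x = 0"
  shows "L2_enorm S w = esqrt (\<integral>\<^sup>+x. ennreal ((w x)\<^sup>2) \<partial>lebesgue)"
proof -
  have "(\<integral>\<^sup>+x. ennreal ((w x)\<^sup>2) \<partial>lebesgue_on S) = (\<integral>\<^sup>+x. ennreal ((w x)\<^sup>2) \<partial>lebesgue)"
    using S zero by (auto simp: nn_integral_restrict_space intro!: nn_integral_cong split: split_indicator)
  then show ?thesis by (simp add: L2_enorm_def)
qed

text \<open>One exceptional null set serves both variables, so representatives may be exchanged in
  any expression that depends on a function only through its values at the two points.\<close>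

lemma AE_pair_eq:
  assumes "AE x in lebesgue. x \<in> D \<longrightarrow> v x = w x"
    and "\<And>x. x \<in> D \<Longrightarrow> E x \<subseteq> D"
    and "\<And>x y. \<lbrakk>v x = w x; v y = w y\<rbrakk> \<Longrightarrow> P x y"
  shows "AE x in lebesgue. x \<in> D \<longrightarrow> (AE y in lebesgue. y \<in> E x \<longrightarrow> P x y)"
  using assms(1)
proof eventually_elim
  case (elim x)
  show ?case
  proof
    assume x: "x \<in> D"
    show "AE y in lebesgue. y \<in> E x \<longrightarrow> P x y"
      using assms(1)
    proof eventually_elim
      case (elim y)
      then show ?case using assms(2)[OF x] assms(3) \<open>x \<in> D \<longrightarrow> v x = w x\<close> x by auto
    qed
  qed
qed

lemma Hs_eseminorm_eq_energy:
  assumes D: "D \<in> sets lebesgue" and [measurable]: "w \<in> borel_measurable lebesgue"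
    and ae: "AE x in lebesgue. x \<in> D \<longrightarrow> v x = w x"
  shows "Hs_eseminorm s D v = esqrt (energy s (D \<times> D) w)"
proof -
  have "(\<integral>\<^sup>+x. (\<integral>\<^sup>+y. ennreal ((v y - v x)\<^sup>2 / norm (y - x) powr (real CARD('a) + 2 * s))
      \<partial>lebesgue_on D) \<partial>lebesgue_on D) = energy s (D \<times> D) w"
    unfolding energy_def
  proof (rule nn_integral_Sigma_lebesgue[OF D])
    show "AE x in lebesgue. x \<in> D \<longrightarrow> (AE y in lebesgue. y \<in> D \<longrightarrow>
        ennreal ((v y - v x)\<^sup>2 / norm (y - x) powr (real CARD('a) + 2 * s)) =
        ennreal (riesz_kernel s (x, y) * (increment w (x, y))\<^sup>2))"
      by (rule AE_pair_eq[OF ae]) (auto simp: riesz_kernel_def increment_def norm_minus_commute)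
  qed (use D in auto)
  then show ?thesis by (simp add: Hs_eseminorm_def)
qed

text \<open>The cutoff in the kernel removes the tail from \<open>D \<times> D\<close> and leaves
  \<open>near \<delta> D\<close>. The factor \<open>c / 4\<close> is the product of
  \<open>1 / 2\<close> in the energy norm and \<open>c / 2\<close> in the kernel.\<close>

lemma energy_eseminorm_eq_energy:
  fixes w :: "real^'n \<Rightarrow> real"
  assumes D: "D \<in> sets lebesgue" and [measurable]: "w \<in> borel_measurable lebesgue"
    and ae: "AE x in lebesgue. x \<in> D \<longrightarrow> v x = w x" and c: "0 \<le> frac_const CARD('n) s"
  shows "energy_eseminorm s \<delta> D v = esqrt (ennreal (frac_const CARD('n) s / 4) * energy s (near \<delta> D) w)"
proof -
  define c where "c = frac_const CARD('n) s"
  have kernel: "trunc_kernel s \<delta> x y = c / 2 * riesz_kernel s (x, y) * indicator (- tail \<delta>) (x, y)" for x y :: "real^'n"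
    by (auto simp: trunc_kernel_def c_def riesz_kernel_def tail_def dist_norm split: split_indicator)
  note [measurable] = sets_near[OF D]
  have "(\<integral>\<^sup>+x. (\<integral>\<^sup>+y. ennreal ((v y - v x)\<^sup>2 * trunc_kernel s \<delta> x y) \<partial>lebesgue_on D) \<partial>lebesgue_on D) =
      (\<integral>\<^sup>+z. ennreal ((increment w z)\<^sup>2 * (c / 2 * riesz_kernel s z * indicator (- tail \<delta>) z)) * indicator (D \<times> D) z
        \<partial>(lebesgue \<Otimes>\<^sub>M lebesgue))"
  proof (rule nn_integral_Sigma_lebesgue[OF D])
    have "- tail \<delta> = space (lebesgue \<Otimes>\<^sub>M lebesgue) - (tail \<delta> :: ((real^'n) \<times> (real^'n)) set)"
      by (auto simp: space_pair_measure)
    then have [measurable]: "- tail \<delta> \<in> sets (lebesgue \<Otimes>\<^sub>M (lebesgue :: (real^'n) measure))"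
      using sets_tail by (metis sets.compl_sets)
    show "(\<lambda>z. ennreal ((increment w z)\<^sup>2 * (c / 2 * riesz_kernel s z * indicator (- tail \<delta>) z))) \<in>
        borel_measurable (lebesgue \<Otimes>\<^sub>M lebesgue)"
      by measurable
    show "AE x in lebesgue. x \<in> D \<longrightarrow> (AE y in lebesgue. y \<in> D \<longrightarrow>
        ennreal ((v y - v x)\<^sup>2 * trunc_kernel s \<delta> x y) =
        ennreal ((increment w (x, y))\<^sup>2 * (c / 2 * riesz_kernel s (x, y) * indicator (- tail \<delta>) (x, y))))"
      by (rule AE_pair_eq[OF ae]) (auto simp: kernel increment_def)
  qed (use D in auto)
  also have "\<dots> = (\<integral>\<^sup>+z. ennreal (c / 2) * (ennreal (riesz_kernel s z * (increment w z)\<^sup>2) * indicator (near \<delta> D) z)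
      \<partial>(lebesgue \<Otimes>\<^sub>M lebesgue))"
    using c by (intro nn_integral_cong)
      (auto simp: near_eq c_def mult_ac simp flip: ennreal_mult split: split_indicator)
  also have "\<dots> = ennreal (c / 2) * energy s (near \<delta> D) w"
    unfolding energy_def by (rule nn_integral_cmult) measurable
  finally have *: "(\<integral>\<^sup>+x. (\<integral>\<^sup>+y. ennreal ((v y - v x)\<^sup>2 * trunc_kernel s \<delta> x y) \<partial>lebesgue_on D) \<partial>lebesgue_on D) =
      ennreal (c / 2) * energy s (near \<delta> D) w" .
  have half: "1 / 2 = ennreal (1 / 2)"
    by (simp add: divide_ennreal flip: ennreal_1 ennreal_numeral)
  have "1 / 2 * ennreal (c / 2) = ennreal (1 / 2 * (c / 2))"
    unfolding half using c by (intro ennreal_mult[symmetric]) (auto simp: c_def)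
  also have "\<dots> = ennreal (c / 4)" by simp
  finally have "1 / 2 * (ennreal (c / 2) * e) = ennreal (c / 4) * e" for e
    by (simp only: mult.assoc[symmetric])
  then show ?thesis
    unfolding energy_eseminorm_def * c_def by (rule arg_cong)
qed

lemma frac_form_eq_pairing:
  fixes a b :: "real^'n \<Rightarrow> real"
  assumes [measurable]: "a' \<in> borel_measurable lebesgue" "b' \<in> borel_measurable lebesgue"
    and ae: "AE x in lebesgue. a x = a' x" "AE x in lebesgue. b x = b' x"
    and fin: "energy s UNIV a' < \<infinity>" "energy s UNIV b' < \<infinity>"
  shows "frac_form s a b = frac_const CARD('n) s / 2 * pairing s UNIV a' b'"
proof -
  have "(LINT x|lebesgue_on UNIV. LINT y|lebesgue_on UNIV.
      (a y - a x) / norm (x - y) powr (real CARD('n) + 2 * s) * (b y - b x)) = pairing s (UNIV \<times> UNIV) a' b'"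
    unfolding pairing_def
  proof (rule integral_Sigma_lebesgue)
    \<comment> \<open>Combining both functions into one map to pairs lets \<open>AE_pair_eq\<close>
      replace them simultaneously.\<close>
    have "AE x in lebesgue. x \<in> UNIV \<longrightarrow> (a x, b x) = (a' x, b' x)"
      using ae by eventually_elim auto
    from AE_pair_eq[OF this, of "\<lambda>_. UNIV"]
    show "AE x in lebesgue. x \<in> UNIV \<longrightarrow> (AE y in lebesgue. y \<in> UNIV \<longrightarrow>
        (a y - a x) / norm (x - y) powr (real CARD('n) + 2 * s) * (b y - b x) = pairing_density s a' b' (x, y))"
      by (auto simp: pairing_density_def increment_def riesz_kernel_def)
    show "integrable (lebesgue \<Otimes>\<^sub>M lebesgue) (\<lambda>z. indicator (UNIV \<times> UNIV) z * pairing_density s a' b' z)"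
      unfolding UNIV_Times_UNIV by (rule integrable_pairing[OF assms(1,2) UNIV_in_sets_lebesgue_pair fin])
  qed auto
  then show ?thesis by (simp add: frac_form_def lebesgue_on_UNIV_eq)
qed

lemma trunc_form_eq_pairing:
  fixes a b :: "real^'n \<Rightarrow> real"
  assumes D: "D \<in> sets lebesgue"
    and [measurable]: "a' \<in> borel_measurable lebesgue" "b' \<in> borel_measurable lebesgue"
    and ae: "AE x in lebesgue. x \<in> D \<longrightarrow> a x = a' x" "AE x in lebesgue. x \<in> D \<longrightarrow> b x = b' x"
    and fin: "energy s (near \<delta> D) a' < \<infinity>" "energy s (near \<delta> D) b' < \<infinity>"
  shows "trunc_form s \<delta> D a b = frac_const CARD('n) s / 2 * pairing s (near \<delta> D) a' b'"
proof -
  have "(LINT x|lebesgue_on D. LINT y|lebesgue_on (D \<inter> cball x \<delta>).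
      (a y - a x) / norm (x - y) powr (real CARD('n) + 2 * s) * (b y - b x)) = pairing s (near \<delta> D) a' b'"
    unfolding pairing_def near_def
  proof (rule integral_Sigma_lebesgue[OF D])
    have "AE x in lebesgue. x \<in> D \<longrightarrow> (a x, b x) = (a' x, b' x)"
      using ae by eventually_elim auto
    then show "AE x in lebesgue. x \<in> D \<longrightarrow> (AE y in lebesgue. y \<in> D \<inter> cball x \<delta> \<longrightarrow>
        (a y - a x) / norm (x - y) powr (real CARD('n) + 2 * s) * (b y - b x) = pairing_density s a' b' (x, y))"
      by (rule AE_pair_eq) (auto simp: pairing_density_def increment_def riesz_kernel_def)
  qed (use sets_near[OF D, of \<delta>] fin in \<open>auto intro!: integrable_pairing simp flip: near_def\<close>)
  then show ?thesis by (simp add: trunc_form_def)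
qed

section \<open>Square integrability, the Cauchy--Schwarz inequality and change of
  representatives\<close>

lemma esqrt_ennreal: "0 \<le> x \<Longrightarrow> esqrt (ennreal x) = ennreal (sqrt x)"
  by (simp add: esqrt_def)

lemma esqrt_less_top_iff: "esqrt a < \<infinity> \<longleftrightarrow> a < \<infinity>"
  by (simp add: esqrt_def less_top)

lemma nn_integral_power2_diff_less_top:
  fixes a b :: "'a \<Rightarrow> real"
  assumes [measurable]: "a \<in> borel_measurable M" "b \<in> borel_measurable M"
    and fin: "(\<integral>\<^sup>+x. ennreal ((a x)\<^sup>2) \<partial>M) < \<infinity>" "(\<integral>\<^sup>+x. ennreal ((b x)\<^sup>2) \<partial>M) < \<infinity>"
  shows "(\<integral>\<^sup>+x. ennreal ((a x - b x)\<^sup>2) \<partial>M) < \<infinity>"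
proof -
  have "(p - q)\<^sup>2 \<le> 2 * (p\<^sup>2 + q\<^sup>2)" for p q :: real
    using zero_le_power2[of "p + q"] by (simp add: power2_eq_square algebra_simps)
  then have "ennreal ((p - q)\<^sup>2) \<le> 2 * (ennreal (p\<^sup>2) + ennreal (q\<^sup>2))" for p q :: real
    by (simp flip: ennreal_plus ennreal_numeral ennreal_mult add: ennreal_leI)
  then have "(\<integral>\<^sup>+x. ennreal ((a x - b x)\<^sup>2) \<partial>M) \<le> (\<integral>\<^sup>+x. 2 * (ennreal ((a x)\<^sup>2) + ennreal ((b x)\<^sup>2)) \<partial>M)"
    by (intro nn_integral_mono)
  also have "\<dots> = 2 * ((\<integral>\<^sup>+x. ennreal ((a x)\<^sup>2) \<partial>M) + (\<integral>\<^sup>+x. ennreal ((b x)\<^sup>2) \<partial>M))"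
    by (subst nn_integral_cmult, measurable, subst nn_integral_add) auto
  also have "\<dots> < \<infinity>" using fin by (simp add: ennreal_mult_less_top)
  finally show ?thesis .
qed

text \<open>Cauchy--Schwarz bounds the square of the integral by a finite number. This excludes the
  value infinity, after which the root is taken in the reals.\<close>

lemma nn_integral_abs_mult_le:
  fixes a b :: "'a \<Rightarrow> real"
  assumes [measurable]: "a \<in> borel_measurable M" "b \<in> borel_measurable M"
    and "(\<integral>\<^sup>+x. ennreal ((a x)\<^sup>2) \<partial>M) = ennreal (\<alpha>\<^sup>2)" "(\<integral>\<^sup>+x. ennreal ((b x)\<^sup>2) \<partial>M) = ennreal (\<beta>\<^sup>2)"
    and "0 \<le> \<alpha>" "0 \<le> \<beta>"
  shows "(\<integral>\<^sup>+x. ennreal \<bar>a x * b x\<bar> \<partial>M) \<le> ennreal (\<alpha> * \<beta>)"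
proof -
  have "(\<integral>\<^sup>+x. ennreal \<bar>a x * b x\<bar> \<partial>M)\<^sup>2 = (\<integral>\<^sup>+x. ennreal \<bar>a x\<bar> * ennreal \<bar>b x\<bar> \<partial>M)\<^sup>2"
    by (simp add: abs_mult ennreal_mult)
  also have "\<dots> \<le> (\<integral>\<^sup>+x. (ennreal \<bar>a x\<bar>)\<^sup>2 \<partial>M) * (\<integral>\<^sup>+x. (ennreal \<bar>b x\<bar>)\<^sup>2 \<partial>M)"
    by (rule Cauchy_Schwarz_nn_integral) measurable
  also have "\<dots> = ennreal ((\<alpha> * \<beta>)\<^sup>2)"
    using assms by (simp add: ennreal_power ennreal_mult power_mult_distrib)
  finally have le: "(\<integral>\<^sup>+x. ennreal \<bar>a x * b x\<bar> \<partial>M)\<^sup>2 \<le> ennreal ((\<alpha> * \<beta>)\<^sup>2)" .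
  show ?thesis
  proof (cases "\<integral>\<^sup>+x. ennreal \<bar>a x * b x\<bar> \<partial>M")
    case (real r)
    then have "r\<^sup>2 \<le> (\<alpha> * \<beta>)\<^sup>2" using le by (simp add: ennreal_power)
    then have "r \<le> \<alpha> * \<beta>" using assms by (intro power2_le_imp_le[of r]) auto
    then show ?thesis using real by (simp add: ennreal_leI)
  next
    case top
    then show ?thesis using le by (simp add: power2_eq_square top_unique)
  qed
qed

lemma Hs_enorm_cong_AE:
  assumes D: "D \<in> sets lebesgue" and w: "w \<in> borel_measurable lebesgue"
    and ae: "AE x in lebesgue. x \<in> D \<longrightarrow> v x = w x"
  shows "Hs_enorm s D v = Hs_enorm s D w"
  using Hs_eseminorm_eq_energy[OF D w ae] Hs_eseminorm_eq_energy[OF D w, of w] L2_enorm_cong_AE[OF D ae]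
  by (simp add: Hs_enorm_def)

section \<open>Truncation\<close>

text \<open>In the tail some point of the pair lies outside \<open>\<Omega>\<close>, where both
  functions vanish, so the product of increments is at most one product of values. Off the tail some
  point lies outside \<open>D\<close>; its partner, at distance at most \<open>\<delta>\<close>,
  cannot be in \<open>\<Omega>\<close>, so neither point is and the density is zero.\<close>

lemma pairing_density_off_near:
  assumes zero: "\<And>x. x \<notin> \<Omega> \<Longrightarrow> a x = 0" "\<And>x. x \<notin> \<Omega> \<Longrightarrow> b x = 0"
    and diam: "\<And>x y. \<lbrakk>x \<in> \<Omega>; y \<in> \<Omega>\<rbrakk> \<Longrightarrow> norm (x - y) \<le> \<delta>"
    and D: "D = \<Omega> \<union> interaction_domain \<delta> \<Omega>"
    and z: "z \<notin> near \<delta> D"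
  shows "\<bar>pairing_density s a b z\<bar> \<le>
    riesz_kernel s z * indicator (tail \<delta>) z * (\<bar>a (fst z) * b (fst z)\<bar> + \<bar>a (snd z) * b (snd z)\<bar>)"
proof -
  obtain x y where xy: "z = (x, y)" by fastforce
  have far: "\<delta> < norm (p - q)" if "p \<in> \<Omega>" "q \<notin> D" for p q
    using that by (force simp: D interaction_domain_def)
  show ?thesis
  proof (cases "z \<in> tail \<delta>")
    case True
    then have "x \<notin> \<Omega> \<or> y \<notin> \<Omega>" using diam[of x y] by (auto simp: xy tail_def)
    then have "\<bar>increment a z * increment b z\<bar> \<le> \<bar>a x * b x\<bar> + \<bar>a y * b y\<bar>"
      using zero by (auto simp: increment_def xy)
    then show ?thesis using True
      by (simp add: pairing_density_def abs_mult xy mult_left_mono)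
  next
    case False
    then have "x \<notin> D \<or> y \<notin> D" using z by (auto simp: near_eq xy)
    moreover have "norm (x - y) \<le> \<delta>" "norm (y - x) \<le> \<delta>"
      using False by (auto simp: xy tail_def norm_minus_commute)
    ultimately have "x \<notin> \<Omega>" "y \<notin> \<Omega>" using far[of x y] far[of y x] D by auto
    then show ?thesis using zero by (simp add: pairing_density_def increment_def xy)
  qed
qed

text \<open>Extension by zero carries finite truncated energy to finite energy on the whole space,
  since the missing part is controlled by the \<open>L^2\<close> norm. This makes the error a valid
  test function in the fractional problem.\<close>

lemma energy_UNIV_le:
  fixes w :: "real^'n \<Rightarrow> real"
  assumes s: "0 < s" "s < 1" and \<delta>: "0 < \<delta>" and [measurable]: "w \<in> borel_measurable lebesgue"
    and zero: "\<And>x. x \<notin> \<Omega> \<Longrightarrow> w x = 0"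
    and diam: "\<And>x y. \<lbrakk>x \<in> \<Omega>; y \<in> \<Omega>\<rbrakk> \<Longrightarrow> norm (x - y) \<le> \<delta>"
    and D: "D = \<Omega> \<union> interaction_domain \<delta> \<Omega>" "D \<in> sets lebesgue"
  shows "energy s UNIV w \<le> energy s (near \<delta> D) w +
    2 * ennreal ((real CARD('n) + 2) * unit_ball_vol (real CARD('n)) / (2 * s) * \<delta> powr (- 2 * s)) *
      (\<integral>\<^sup>+x. ennreal ((w x)\<^sup>2) \<partial>lebesgue)"
proof -
  note [measurable] = sets_near[OF D(2)]
  let ?tail = "\<lambda>z. ennreal (riesz_kernel s z) * indicator (tail \<delta>) z * (ennreal ((w (fst z))\<^sup>2) + ennreal ((w (snd z))\<^sup>2))"
  have "energy s UNIV w \<le> (\<integral>\<^sup>+z. ennreal (riesz_kernel s z * (increment w z)\<^sup>2) * indicator (near \<delta> D) z + ?tail z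
      \<partial>(lebesgue \<Otimes>\<^sub>M lebesgue))"
    unfolding energy_def
  proof (rule nn_integral_mono)
    fix z :: "(real^'n) \<times> (real^'n)"
    show "ennreal (riesz_kernel s z * (increment w z)\<^sup>2) * indicator UNIV z \<le>
        ennreal (riesz_kernel s z * (increment w z)\<^sup>2) * indicator (near \<delta> D) z + ?tail z"
    proof (cases "z \<in> near \<delta> D")
      case False
      have "riesz_kernel s z * (increment w z)\<^sup>2 \<le>
          riesz_kernel s z * indicator (tail \<delta>) z * ((w (fst z))\<^sup>2 + (w (snd z))\<^sup>2)"
        using pairing_density_off_near[where a = w and b = w and s = s, OF zero zero diam D(1) False]
        by (simp add: pairing_density_def power2_eq_square abs_mult)
      then have "ennreal (riesz_kernel s z * (increment w z)\<^sup>2) \<le>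
          ennreal (riesz_kernel s z * indicator (tail \<delta>) z * ((w (fst z))\<^sup>2 + (w (snd z))\<^sup>2))"
        by (rule ennreal_leI)
      also have "\<dots> = ?tail z"
        by (simp flip: ennreal_plus ennreal_mult split: split_indicator)
      finally show ?thesis using False by simp
    qed simp
  qed
  also have "\<dots> = energy s (near \<delta> D) w + (\<integral>\<^sup>+z. ?tail z \<partial>(lebesgue \<Otimes>\<^sub>M lebesgue))"
    unfolding energy_def by (rule nn_integral_add) measurable
  also have "(\<integral>\<^sup>+z. ?tail z \<partial>(lebesgue \<Otimes>\<^sub>M lebesgue)) \<le>
      2 * ennreal ((real CARD('n) + 2) * unit_ball_vol (real CARD('n)) / (2 * s) * \<delta> powr (- 2 * s)) *
      (\<integral>\<^sup>+x. ennreal ((w x)\<^sup>2) \<partial>lebesgue)"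
    by (rule nn_integral_riesz_kernel_tail_add[OF s \<delta>]) measurable
  finally show ?thesis by (simp add: add_left_mono)
qed

text \<open>The consistency error of the truncation is of order zero: it is controlled by the
  product of values alone, because the kernel is integrable away from the diagonal.\<close>

lemma pairing_UNIV_minus_near:
  fixes a b :: "real^'n \<Rightarrow> real"
  assumes s: "0 < s" "s < 1" and \<delta>: "0 < \<delta>"
    and [measurable]: "a \<in> borel_measurable lebesgue" "b \<in> borel_measurable lebesgue"
    and zero: "\<And>x. x \<notin> \<Omega> \<Longrightarrow> a x = 0" "\<And>x. x \<notin> \<Omega> \<Longrightarrow> b x = 0"
    and diam: "\<And>x y. \<lbrakk>x \<in> \<Omega>; y \<in> \<Omega>\<rbrakk> \<Longrightarrow> norm (x - y) \<le> \<delta>"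
    and D: "D = \<Omega> \<union> interaction_domain \<delta> \<Omega>" "D \<in> sets lebesgue"
    and fin: "energy s UNIV a < \<infinity>" "energy s UNIV b < \<infinity>"
  shows "ennreal \<bar>pairing s UNIV a b - pairing s (near \<delta> D) a b\<bar> \<le>
    2 * ennreal ((real CARD('n) + 2) * unit_ball_vol (real CARD('n)) / (2 * s) * \<delta> powr (- 2 * s)) *
      (\<integral>\<^sup>+x. ennreal \<bar>a x * b x\<bar> \<partial>lebesgue)"
proof -
  note [measurable] = sets_near[OF D(2)]
  have near_fin: "energy s (near \<delta> D) v < \<infinity>" if "energy s UNIV v < \<infinity>" for v
    using energy_mono[of "near \<delta> D" UNIV s v] that by auto
  let ?g = "\<lambda>z. indicator UNIV z * pairing_density s a b z - indicator (near \<delta> D) z * pairing_density s a b z"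
  have int: "integrable (lebesgue \<Otimes>\<^sub>M lebesgue) (\<lambda>z. indicator UNIV z * pairing_density s a b z)"
    "integrable (lebesgue \<Otimes>\<^sub>M lebesgue) (\<lambda>z. indicator (near \<delta> D) z * pairing_density s a b z)"
    by (rule integrable_pairing; use fin near_fin in measurable)+
  have "pairing s UNIV a b - pairing s (near \<delta> D) a b = (LINT z|(lebesgue \<Otimes>\<^sub>M lebesgue). ?g z)"
    unfolding pairing_def using int by (rule Bochner_Integration.integral_diff[symmetric])
  then have "ennreal \<bar>pairing s UNIV a b - pairing s (near \<delta> D) a b\<bar> \<le>
      (\<integral>\<^sup>+z. ennreal (norm (?g z)) \<partial>(lebesgue \<Otimes>\<^sub>M lebesgue))"
    using integral_norm_bound_ennreal[OF Bochner_Integration.integrable_diff[OF int]] by simp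
  also have "\<dots> \<le> (\<integral>\<^sup>+z. ennreal (riesz_kernel s z) * indicator (tail \<delta>) z *
      (ennreal \<bar>a (fst z) * b (fst z)\<bar> + ennreal \<bar>a (snd z) * b (snd z)\<bar>) \<partial>(lebesgue \<Otimes>\<^sub>M lebesgue))"
  proof (rule nn_integral_mono)
    fix z :: "(real^'n) \<times> (real^'n)"
    show "ennreal (norm (?g z)) \<le> ennreal (riesz_kernel s z) * indicator (tail \<delta>) z *
        (ennreal \<bar>a (fst z) * b (fst z)\<bar> + ennreal \<bar>a (snd z) * b (snd z)\<bar>)"
    proof (cases "z \<in> near \<delta> D")
      case False
      have "\<bar>pairing_density s a b z\<bar> \<le>
          riesz_kernel s z * indicator (tail \<delta>) z * (\<bar>a (fst z) * b (fst z)\<bar> + \<bar>a (snd z) * b (snd z)\<bar>)"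
        by (rule pairing_density_off_near[OF zero diam D(1) False])
      then show ?thesis using False
        by (auto simp flip: ennreal_plus ennreal_mult split: split_indicator intro: ennreal_leI)
    qed simp
  qed
  also have "\<dots> \<le> 2 * ennreal ((real CARD('n) + 2) * unit_ball_vol (real CARD('n)) / (2 * s) * \<delta> powr (- 2 * s)) *
      (\<integral>\<^sup>+x. ennreal \<bar>a x * b x\<bar> \<partial>lebesgue)"
    by (rule nn_integral_riesz_kernel_tail_add[OF s \<delta>]) measurable
  finally show ?thesis .
qed

text \<open>The estimate first comes with \<open>\<delta>\<close> itself in place of its excess over
  the covering radius. The divisor 4 in \<open>K\<close> collects \<open>1 / 4\<close> from the
  squared energy norm, 2 from the two variables of the tail and \<open>1 / 2\<close> from the tail
  integral.\<close>

lemma truncation_error: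
  fixes \<Omega> :: "(real^'n) set"
  assumes s: "0 < s" "s < 1" and \<Omega>: "open \<Omega>"
    and \<delta>: "0 < \<delta>" and diam: "\<And>x y. \<lbrakk>x \<in> \<Omega>; y \<in> \<Omega>\<rbrakk> \<Longrightarrow> norm (x - y) \<le> \<delta>"
    and u: "frac_solution s \<Omega> f u" and ut: "trunc_solution s \<delta> \<Omega> f ut"
    and c: "0 < frac_const CARD('n) s" "frac_const CARD('n) s \<le> B"
    and C1: "0 < C1"
    and coercive: "\<And>v. v \<in> Vc_space s \<delta> \<Omega> \<Longrightarrow>
      ennreal C1 * Hs_enorm s (\<Omega> \<union> interaction_domain \<delta> \<Omega>) v \<le>
        energy_eseminorm s \<delta> (\<Omega> \<union> interaction_domain \<delta> \<Omega>) v"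
  defines "K \<equiv> B * ((real CARD('n) + 2) * unit_ball_vol (real CARD('n))) / 4"
  shows "Hs_enorm s (\<Omega> \<union> interaction_domain \<delta> \<Omega>) (\<lambda>x. u x - ut x) \<le>
      ennreal (K / (C1\<^sup>2 * s * \<delta> powr (2 * s))) * L2_enorm \<Omega> u" (is ?H)
    and "L2_enorm \<Omega> (\<lambda>x. u x - ut x) \<le>
      ennreal (K / (C1\<^sup>2 * s * \<delta> powr (2 * s))) * L2_enorm \<Omega> u" (is ?L)
proof -
  define D where "D = \<Omega> \<union> interaction_domain \<delta> \<Omega>"
  define c where "c = frac_const CARD('n) s"
  define T where "T = (real CARD('n) + 2) * unit_ball_vol (real CARD('n)) / (2 * s) * \<delta> powr (- 2 * s)"
  have T0: "0 \<le> T" using s by (simp add: T_def)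
  have D_meas: "D \<in> sets lebesgue" and \<Omega>_meas: "\<Omega> \<in> sets lebesgue"
    using open_Un_interaction_domain[OF \<Omega> \<delta>] \<Omega> by (auto simp: D_def)
  note near_meas [measurable] = sets_near[OF D_meas, of \<delta>]

  \<comment> \<open>These representatives vanish everywhere, not just almost everywhere, off
    \<open>\<Omega>\<close> and are measurable on the whole space, whereas measurability of
    \<open>ut\<close> is given on \<open>D\<close> only.\<close>
  define u0 where "u0 x = (if x \<in> \<Omega> then u x else 0)" for x
  define ut0 where "ut0 x = (if x \<in> \<Omega> then ut x else 0)" for x
  define w where "w x = u0 x - ut0 x" for x
  have zero: "u0 x = 0" "ut0 x = 0" "w x = 0" if "x \<notin> \<Omega>" for x
    using that by (auto simp: u0_def ut0_def w_def)
  have zero_D: "u0 x = 0" "ut0 x = 0" "w x = 0" if "x \<notin> D" for x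
    using that zero[of x] by (auto simp: D_def)

  have u_space: "u \<in> Hs_space s UNIV" "AE x in lebesgue. x \<notin> \<Omega> \<longrightarrow> u x = 0"
    and u_test: "\<And>v. v \<in> Hs_zero_space s \<Omega> \<Longrightarrow> frac_form s u v = (LINT x|lebesgue_on \<Omega>. f x * v x)"
    using u by (auto simp: frac_solution_def Hs_zero_space_def)
  have ut_space: "ut \<in> V_space s \<delta> D" "AE x in lebesgue. x \<in> interaction_domain \<delta> \<Omega> \<longrightarrow> ut x = 0"
    and ut_test: "\<And>v. v \<in> Vc_space s \<delta> \<Omega> \<Longrightarrow> trunc_form s \<delta> D ut v = (LINT x|lebesgue_on \<Omega>. f x * v x)"
    using ut by (auto simp: trunc_solution_def Vc_space_def D_def)

  have u_meas: "u \<in> borel_measurable lebesgue"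
    using u_space(1) by (simp add: Hs_space_def L2_space_def lebesgue_on_UNIV_eq)
  then have [measurable]: "u0 \<in> borel_measurable lebesgue"
    unfolding u0_def[abs_def] using \<Omega>_meas by (intro borel_measurable_if_I measurable_restrict_space1) auto
  have "ut \<in> borel_measurable (lebesgue_on D)"
    using ut_space(1) by (simp add: V_space_def L2_space_def)
  then have "ut \<in> borel_measurable (lebesgue_on \<Omega>)"
    by (rule measurable_restrict_mono) (auto simp: D_def)
  then have [measurable]: "ut0 \<in> borel_measurable lebesgue"
    unfolding ut0_def[abs_def] using \<Omega>_meas by (rule borel_measurable_if_I)
  have [measurable]: "w \<in> borel_measurable lebesgue"
    unfolding w_def[abs_def] by measurable
  have u_ae: "AE x in lebesgue. u x = u0 x"
    using u_space(2) by eventually_elim (auto simp: u0_def)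
  have ut_ae: "AE x in lebesgue. x \<in> D \<longrightarrow> ut x = ut0 x"
    using ut_space(2) by eventually_elim (auto simp: ut0_def D_def)
  have w_ae: "AE x in lebesgue. x \<in> D \<longrightarrow> u x - ut x = w x"
    using u_ae ut_ae by eventually_elim (auto simp: w_def)

  have u_L2: "(\<integral>\<^sup>+x. ennreal ((u0 x)\<^sup>2) \<partial>lebesgue) < \<infinity>"
  proof -
    have "L2_enorm UNIV u0 < \<infinity>"
      using u_space(1) L2_enorm_cong_AE[of UNIV u u0] u_ae by (simp add: Hs_space_def L2_space_def)
    then show ?thesis by (simp add: L2_enorm_def esqrt_less_top_iff[simplified] lebesgue_on_UNIV_eq)
  qed
  have ut_L2: "(\<integral>\<^sup>+x. ennreal ((ut0 x)\<^sup>2) \<partial>lebesgue) < \<infinity>"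
  proof -
    have "L2_enorm D ut0 < \<infinity>"
      using ut_space(1) L2_enorm_cong_AE[OF D_meas ut_ae] by (simp add: V_space_def L2_space_def)
    then show ?thesis
      by (simp add: L2_enorm_eq_UNIV[OF D_meas zero_D(2)] esqrt_less_top_iff[simplified])
  qed
  have w_L2: "(\<integral>\<^sup>+x. ennreal ((w x)\<^sup>2) \<partial>lebesgue) < \<infinity>"
    unfolding w_def using u_L2 ut_L2 by (intro nn_integral_power2_diff_less_top) measurable

  have u_energy: "energy s UNIV u0 < \<infinity>"
  proof -
    have "Hs_eseminorm s UNIV u < \<infinity>"
      using u_space(1) by (simp add: Hs_space_def Hs_enorm_def)
    then show ?thesis
      using Hs_eseminorm_eq_energy[of UNIV u0 u s] u_ae by (simp add: esqrt_less_top_iff[simplified])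
  qed
  then have u_energy_near: "energy s (near \<delta> D) u0 < \<infinity>"
    using energy_mono[of "near \<delta> D" UNIV s u0] by (auto simp: less_top top_unique)
  have ut_energy: "energy s (near \<delta> D) ut0 < \<infinity>"
  proof -
    have "energy_eseminorm s \<delta> D ut < \<infinity>"
      using ut_space(1) by (simp add: V_space_def)
    then show ?thesis
      using energy_eseminorm_eq_energy[OF D_meas _ ut_ae, of s \<delta>] c(1)
      by (auto simp: esqrt_less_top_iff[simplified] ennreal_mult_less_top)
  qed
  have w_energy: "energy s (near \<delta> D) w < \<infinity>"
    unfolding w_def using u_energy_near ut_energy by (intro energy_diff_less_top) measurable
  have w_energy_UNIV: "energy s UNIV w < \<infinity>"
  proof -
    have "energy s UNIV w \<le> energy s (near \<delta> D) w + 2 * ennreal T * (\<integral>\<^sup>+x. ennreal ((w x)\<^sup>2) \<partial>lebesgue)"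
      unfolding T_def by (rule energy_UNIV_le[OF s \<delta> _ zero(3) diam D_def D_meas]) auto
    also have "\<dots> < \<infinity>"
      using w_energy w_L2 by (simp add: ennreal_mult_less_top)
    finally show ?thesis .
  qed

  have w_norm: "L2_enorm S w = esqrt (\<integral>\<^sup>+x. ennreal ((w x)\<^sup>2) \<partial>lebesgue)"
    if "S \<in> sets lebesgue" "\<Omega> \<subseteq> S" for S
    using that zero(3) by (intro L2_enorm_eq_UNIV) auto
  have w_seminorm: "energy_eseminorm s \<delta> D w = esqrt (ennreal (c / 4) * energy s (near \<delta> D) w)"
    unfolding c_def using c(1) by (intro energy_eseminorm_eq_energy D_meas) auto
  have w_Vc: "w \<in> Vc_space s \<delta> \<Omega>"
  proof -
    have "w \<in> borel_measurable (lebesgue_on D)" by (rule measurable_restrict_space1) measurable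
    moreover have "L2_enorm D w < \<infinity>"
      using w_norm[OF D_meas] w_L2 by (simp add: D_def esqrt_less_top_iff[simplified])
    moreover have "energy_eseminorm s \<delta> D w < \<infinity>"
      using w_energy by (simp add: w_seminorm esqrt_less_top_iff[simplified] ennreal_mult_less_top)
    moreover have "AE x in lebesgue. x \<in> interaction_domain \<delta> \<Omega> \<longrightarrow> w x = 0"
      using zero(3) by (intro AE_I2) (auto simp: interaction_domain_def)
    ultimately show ?thesis by (simp add: Vc_space_def V_space_def L2_space_def flip: D_def)
  qed
  have w_Hs: "w \<in> Hs_zero_space s \<Omega>"
  proof -
    have "L2_enorm UNIV w < \<infinity>"
      using w_norm[of UNIV] w_L2 by (simp add: esqrt_less_top_iff[simplified])
    moreover have "Hs_eseminorm s UNIV w < \<infinity>"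
      using Hs_eseminorm_eq_energy[of UNIV w w s] w_energy_UNIV by (simp add: esqrt_less_top_iff[simplified])
    moreover have "AE x in lebesgue. x \<notin> \<Omega> \<longrightarrow> w x = 0"
      using zero(3) by (intro AE_I2) auto
    ultimately show ?thesis
      by (simp add: Hs_zero_space_def Hs_space_def L2_space_def Hs_enorm_def lebesgue_on_UNIV_eq)
  qed

  \<comment> \<open>Both problems have the same load, and the common positive factor
    \<open>c / 2\<close> cancels from the two forms.\<close>
  have "frac_form s u w = trunc_form s \<delta> D ut w"
    using u_test[OF w_Hs] ut_test[OF w_Vc] by simp
  moreover have "frac_form s u w = c / 2 * pairing s UNIV u0 w"
    unfolding c_def using u_ae u_energy w_energy_UNIV by (intro frac_form_eq_pairing) auto
  moreover have "trunc_form s \<delta> D ut w = c / 2 * pairing s (near \<delta> D) ut0 w"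
    unfolding c_def using ut_ae ut_energy w_energy by (intro trunc_form_eq_pairing D_meas) auto
  ultimately have same: "pairing s UNIV u0 w = pairing s (near \<delta> D) ut0 w"
    using c(1) by (simp add: c_def)
  \<comment> \<open>By \<open>same\<close> the term with \<open>ut0\<close> is the full pairing of
    \<open>u0\<close> with \<open>w\<close>, so only the consistency error of \<open>u0\<close>
    against \<open>w\<close> remains.\<close>
  have "pairing s (near \<delta> D) w w = pairing s (near \<delta> D) u0 w - pairing s (near \<delta> D) ut0 w"
    using pairing_diff_left[OF integrable_pairing integrable_pairing, of u0 w "near \<delta> D" s ut0]
      u_energy_near ut_energy w_energy near_meas by (simp flip: w_def)
  then have "pairing s (near \<delta> D) w w \<le> \<bar>pairing s UNIV u0 w - pairing s (near \<delta> D) u0 w\<bar>"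
    using same by simp
  then have "energy s (near \<delta> D) w \<le> ennreal \<bar>pairing s UNIV u0 w - pairing s (near \<delta> D) u0 w\<bar>"
    using energy_eq_pairing[of w "near \<delta> D" s] w_energy by (simp add: ennreal_leI)
  also have "\<dots> \<le> 2 * ennreal T * (\<integral>\<^sup>+x. ennreal \<bar>u0 x * w x\<bar> \<partial>lebesgue)"
    unfolding T_def
    by (rule pairing_UNIV_minus_near[OF s \<delta> _ _ zero(1) zero(3) diam D_def D_meas u_energy w_energy_UNIV]) auto
  finally have energy_le: "energy s (near \<delta> D) w \<le> 2 * ennreal T * (\<integral>\<^sup>+x. ennreal \<bar>u0 x * w x\<bar> \<partial>lebesgue)" .

  \<comment> \<open>All quantities are now finite and the argument continues in the reals:
    \<open>\<alpha>\<close> and \<open>\<beta>\<close> are the \<open>L^2\<close> norms of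
    \<open>u\<close> and of the error, \<open>P\<close> is the truncated energy of the error and
    \<open>h\<close> its full norm.\<close>
  define \<alpha> where "\<alpha> = sqrt (enn2real (\<integral>\<^sup>+x. ennreal ((u0 x)\<^sup>2) \<partial>lebesgue))"
  define \<beta> where "\<beta> = sqrt (enn2real (\<integral>\<^sup>+x. ennreal ((w x)\<^sup>2) \<partial>lebesgue))"
  define P where "P = enn2real (energy s (near \<delta> D) w)"
  define h where "h = enn2real (Hs_enorm s D w)"
  have nonneg: "0 \<le> \<alpha>" "0 \<le> \<beta>" "0 \<le> P" "0 \<le> h"
    by (auto simp: \<alpha>_def \<beta>_def P_def h_def)
  have \<alpha>2: "(\<integral>\<^sup>+x. ennreal ((u0 x)\<^sup>2) \<partial>lebesgue) = ennreal (\<alpha>\<^sup>2)"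
    using u_L2 by (simp add: \<alpha>_def)
  have \<beta>2: "(\<integral>\<^sup>+x. ennreal ((w x)\<^sup>2) \<partial>lebesgue) = ennreal (\<beta>\<^sup>2)"
    using w_L2 by (simp add: \<beta>_def)
  have P: "energy s (near \<delta> D) w = ennreal P"
    using w_energy by (simp add: P_def)
  have "AE x in lebesgue. x \<in> \<Omega> \<longrightarrow> u x = u0 x"
    by (simp add: u0_def)
  then have u_norm: "L2_enorm \<Omega> u = ennreal \<alpha>"
    using L2_enorm_cong_AE[OF \<Omega>_meas, of u u0] L2_enorm_eq_UNIV[OF \<Omega>_meas zero(1)] nonneg
    by (simp add: \<alpha>2 esqrt_ennreal)
  have w_norm_\<beta>: "L2_enorm D w = ennreal \<beta>" "L2_enorm \<Omega> w = ennreal \<beta>"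
    using w_norm[OF D_meas] w_norm[OF \<Omega>_meas] nonneg by (auto simp: D_def \<beta>2 esqrt_ennreal)
  have seminorm_P: "energy_eseminorm s \<delta> D w = ennreal (sqrt (c / 4 * P))"
    using c(1) nonneg by (simp add: w_seminorm P c_def esqrt_ennreal flip: ennreal_mult)
  have coercive_w: "ennreal C1 * Hs_enorm s D w \<le> ennreal (sqrt (c / 4 * P))"
    using coercive[OF w_Vc] by (simp add: seminorm_P flip: D_def)
  \<comment> \<open>Coercivity itself yields finiteness; positivity of \<open>C1\<close> matters
    because \<open>0 * \<infinity> = 0\<close> in \<open>ennreal\<close>.\<close>
  have h: "Hs_enorm s D w = ennreal h"
  proof -
    have "ennreal C1 * Hs_enorm s D w < \<infinity>"
      using coercive_w by (simp add: le_less_trans[OF _ ennreal_less_top])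
    then show ?thesis using C1 by (auto simp: h_def ennreal_mult_less_top)
  qed
  have "ennreal \<beta> \<le> ennreal h"
    by (simp add: Hs_enorm_def w_norm_\<beta> flip: h)
  then have \<beta>h: "\<beta> \<le> h" using nonneg by simp
  have C1h: "C1 * h \<le> sqrt (c / 4 * P)"
    using coercive_w C1 c(1) nonneg by (simp add: h c_def flip: ennreal_mult)
  have "ennreal P \<le> 2 * ennreal T * ennreal (\<alpha> * \<beta>)"
    unfolding P[symmetric] using nonneg
    by (intro order.trans[OF energy_le] mult_left_mono nn_integral_abs_mult_le \<alpha>2 \<beta>2) auto
  also have "\<dots> = ennreal (2 * T * (\<alpha> * \<beta>))"
    using T0 nonneg by (simp add: ennreal_mult)
  finally have P_le: "P \<le> 2 * T * (\<alpha> * \<beta>)"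
    using T0 nonneg by simp
  have "C1\<^sup>2 * h\<^sup>2 = (C1 * h)\<^sup>2" by (simp add: power_mult_distrib)
  also have "\<dots> \<le> (sqrt (c / 4 * P))\<^sup>2"
    using C1h C1 nonneg by (intro power_mono) auto
  also have "\<dots> = c / 4 * P" using c(1) nonneg by (simp add: c_def)
  \<comment> \<open>Replacing \<open>\<beta>\<close> by the larger \<open>h\<close> leaves one
    factor \<open>h\<close> on the right, to be cancelled against the square on the left;
    \<open>B\<close> removes the dependence of the normalizing constant on \<open>s\<close>.\<close>
  also have "\<dots> \<le> B / 4 * (2 * T * (\<alpha> * h))"
  proof (rule mult_mono)
    show "P \<le> 2 * T * (\<alpha> * h)"
      using P_le T0 nonneg \<beta>h by (meson mult_left_mono mult_nonneg_nonneg order.trans zero_le_numeral)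
  qed (use c nonneg in \<open>auto simp: c_def\<close>)
  finally have sq: "C1\<^sup>2 * h * h \<le> B * T / 2 * \<alpha> * h"
    by (simp add: power2_eq_square mult_ac)
  have main: "h \<le> K / (C1\<^sup>2 * s * \<delta> powr (2 * s)) * \<alpha>"
  proof -
    have "C1\<^sup>2 * h \<le> B * T / 2 * \<alpha>"
    proof (cases "h = 0")
      case True
      then show ?thesis using c T0 nonneg by simp
    next
      case False
      then show ?thesis using sq nonneg by (simp add: mult_le_cancel_right)
    qed
    then have "h \<le> B * T / 2 * \<alpha> / C1\<^sup>2"
      using C1 by (simp add: field_simps)
    also have "\<dots> = K / (C1\<^sup>2 * s * \<delta> powr (2 * s)) * \<alpha>"
      using s \<delta> C1 by (simp add: K_def T_def powr_minus field_simps)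
    finally show ?thesis .
  qed
  have K0: "0 \<le> K / (C1\<^sup>2 * s * \<delta> powr (2 * s))"
    using c s by (simp add: K_def)
  have h_le: "ennreal h \<le> ennreal (K / (C1\<^sup>2 * s * \<delta> powr (2 * s))) * L2_enorm \<Omega> u"
    unfolding u_norm using main K0 nonneg by (simp add: ennreal_leI flip: ennreal_mult)
  then show ?H
    using Hs_enorm_cong_AE[OF D_meas _ w_ae, of s] by (simp add: h flip: D_def)
  have "AE x in lebesgue. x \<in> \<Omega> \<longrightarrow> u x - ut x = w x"
    using w_ae by eventually_elim (auto simp: D_def)
  then have "L2_enorm \<Omega> (\<lambda>x. u x - ut x) = ennreal \<beta>"
    using L2_enorm_cong_AE[OF \<Omega>_meas] w_norm_\<beta>(2) by simp
  also have "\<dots> \<le> ennreal h" using \<beta>h by (rule ennreal_leI)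
  finally show ?L using h_le by (rule order.trans)
qed

theorem theorem3p1:
  shows "\<exists>K::real. K > 0 \<and>
    (\<forall>(s::real) (\<Omega>::(real^'n) set) (\<delta>::real) (f::real^'n \<Rightarrow> real)
       (u::real^'n \<Rightarrow> real) (ut::real^'n \<Rightarrow> real) (C1::real).
       0 < s \<longrightarrow> s < 1 \<longrightarrow>
       open \<Omega> \<longrightarrow> \<Omega> \<noteq> {} \<longrightarrow>
       admissible_domain \<Omega> \<longrightarrow>
       admissible_domain (interaction_domain \<delta> \<Omega>) \<longrightarrow>
       admissible_domain (\<Omega> \<union> interaction_domain \<delta> \<Omega>) \<longrightarrow>
       covering_radius \<Omega> < \<delta> \<longrightarrow>
       f \<in> L2_space \<Omega> \<longrightarrow>
       frac_solution s \<Omega> f u \<longrightarrow>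
       trunc_solution s \<delta> \<Omega> f ut \<longrightarrow>
       0 < C1 \<longrightarrow>
       (\<forall>v \<in> Vc_space s \<delta> \<Omega>.
          ennreal C1 * Hs_enorm s (\<Omega> \<union> interaction_domain \<delta> \<Omega>) v
            \<le> energy_eseminorm s \<delta> (\<Omega> \<union> interaction_domain \<delta> \<Omega>) v) \<longrightarrow>
       Hs_enorm s (\<Omega> \<union> interaction_domain \<delta> \<Omega>) (\<lambda>x. u x - ut x)
         \<le> ennreal (K / (C1\<^sup>2 * s * (\<delta> - covering_radius \<Omega>) powr (2 * s))) * L2_enorm \<Omega> u \<and>
       L2_enorm \<Omega> (\<lambda>x. u x - ut x)
         \<le> ennreal (K / (C1\<^sup>2 * s * (\<delta> - covering_radius \<Omega>) powr (2 * s))) * L2_enorm \<Omega> u)"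
proof -
  obtain B where B: "0 < B"
    "\<And>s. \<lbrakk>0 < s; s < 1\<rbrakk> \<Longrightarrow> 0 < frac_const CARD('n) s \<and> frac_const CARD('n) s \<le> B"
    using frac_const_bounds[of "CARD('n)"] by auto
  define K where "K = B * ((real CARD('n) + 2) * unit_ball_vol (real CARD('n))) / 4"
  have K0: "0 < K" using B(1) by (simp add: K_def)
  show ?thesis
  proof (intro exI[of _ K] conjI allI impI K0)
    fix s \<delta> C1 :: real and \<Omega> :: "(real^'n) set" and f u ut :: "real^'n \<Rightarrow> real"
    assume s: "0 < s" "s < 1" and \<Omega>: "open \<Omega>" "\<Omega> \<noteq> {}" "admissible_domain \<Omega>"
      and \<delta>: "covering_radius \<Omega> < \<delta>"
      and sol: "frac_solution s \<Omega> f u" "trunc_solution s \<delta> \<Omega> f ut" and C1: "0 < C1"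
      and coercive: "\<forall>v \<in> Vc_space s \<delta> \<Omega>.
          ennreal C1 * Hs_enorm s (\<Omega> \<union> interaction_domain \<delta> \<Omega>) v
            \<le> energy_eseminorm s \<delta> (\<Omega> \<union> interaction_domain \<delta> \<Omega>) v"
    define I where "I = covering_radius \<Omega>"
    have bdd: "bounded \<Omega>" using \<Omega>(3) by (simp add: admissible_domain_def)
    then have I: "I = diameter \<Omega>" "0 \<le> I"
      using covering_radius_eq_diameter[OF bdd \<Omega>(2)] diameter_ge_0[OF bdd] by (auto simp: I_def)
    have \<delta>0: "0 < \<delta>" using I \<delta> by (simp add: I_def)
    have diam: "norm (x - y) \<le> \<delta>" if "x \<in> \<Omega>" "y \<in> \<Omega>" for x y
      using diameter_bounded_bound[OF bdd that] I \<delta> by (simp add: I_def dist_norm)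
    \<comment> \<open>The diameter is nonnegative and the exponent \<open>2 * s\<close> positive, so
      passing from \<open>\<delta>\<close> to the positive number \<open>\<delta> - I\<close> only
      enlarges the bound.\<close>
    have "\<delta> - I \<le> \<delta>" "0 < \<delta> - I" using I \<delta> by (auto simp: I_def)
    then have "K / (C1\<^sup>2 * s * \<delta> powr (2 * s)) \<le> K / (C1\<^sup>2 * s * (\<delta> - I) powr (2 * s))"
      using K0 s C1 \<delta>0 by (intro divide_left_mono mult_left_mono powr_mono2 mult_pos_pos) auto
    then have le: "ennreal (K / (C1\<^sup>2 * s * \<delta> powr (2 * s))) * L2_enorm \<Omega> u \<le>
        ennreal (K / (C1\<^sup>2 * s * (\<delta> - covering_radius \<Omega>) powr (2 * s))) * L2_enorm \<Omega> u"
      by (intro mult_right_mono ennreal_leI) (auto simp: I_def)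
    note error = truncation_error[OF s \<Omega>(1) \<delta>0 diam sol conjunct1[OF B(2)[OF s]] conjunct2[OF B(2)[OF s]]
        C1 bspec[OF coercive], folded K_def]
    show "Hs_enorm s (\<Omega> \<union> interaction_domain \<delta> \<Omega>) (\<lambda>x. u x - ut x)
        \<le> ennreal (K / (C1\<^sup>2 * s * (\<delta> - covering_radius \<Omega>) powr (2 * s))) * L2_enorm \<Omega> u"
      by (rule order.trans[OF error(1) le])
    show "L2_enorm \<Omega> (\<lambda>x. u x - ut x)
        \<le> ennreal (K / (C1\<^sup>2 * s * (\<delta> - covering_radius \<Omega>) powr (2 * s))) * L2_enorm \<Omega> u"
      by (rule order.trans[OF error(2) le])
  qed
qed

end
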